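(* Let $(g,J)$ be a left invariant anti-Kähler structure on a Lie group $G$ with Lie algebra $\mathfrak{g}$ such that $J$ is an abelian complex structure, i.e. $[JX,JY]=[X,Y]$ for all $X,Y\in\mathfrak{g}$. Then $(G,g)$ is flat, i.e. the Riemannian curvature tensor of the pseudo-Riemannian metric $g$ vanishes identically.
   Context: The Lie algebra $\mathfrak{g}$ of $G$ is the space of left invariant vector fields on $G$. A left invariant anti-Kähler structure on $G$ is a pair $(g,J)$ where $g$ is a left invariant pseudo-Riemannian metric on $G$, $J$ is a left invariant almost complex structure on $G$ (so $J$ maps $\mathfrak{g}$ to $\mathfrak{g}$ and $J^2=-\mathrm{Id}$), $g(JX,JY)=-g(X,Y)$ for all $X,Y$, and $\nabla J=0$ where $\nabla$ is the Levi-Civita connection of $g$. *)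

theory Defs
  imports "HOL-Analysis.Analysis"
begin

section \<open>Smooth maps between open subsets of Euclidean spaces\<close>

text \<open>
  Meant for open \<open>S\<close>. Asking for all directional derivatives to be of class \<open>C^k\<close> is the same as
  asking for the partial derivatives, since the spaces are finite-dimensional.
\<close>

primrec Ck_on :: "nat \<Rightarrow> 'a::euclidean_space set \<Rightarrow> ('a \<Rightarrow> 'b::euclidean_space) \<Rightarrow> bool" where
  "Ck_on 0 S f \<longleftrightarrow> continuous_on S f"
| "Ck_on (Suc k) S f \<longleftrightarrow>
     (\<forall>x\<in>S. f differentiable (at x)) \<and>
     (\<forall>v. Ck_on k S (\<lambda>x. frechet_derivative f (at x) v))"

definition smooth_on :: "'a::euclidean_space set \<Rightarrow> ('a \<Rightarrow> 'b::euclidean_space) \<Rightarrow> bool" where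
  "smooth_on S f \<longleftrightarrow> (\<forall>k. Ck_on k S f)"


section \<open>Smooth manifolds\<close>

text \<open>
  A chart is a pair of its domain and its coordinate map; the values of the coordinate map outside
  the domain are irrelevant. A manifold is a Hausdorff second countable type with a smooth atlas,
  not required to be maximal: everything below depends only on the smooth structure it generates.
\<close>

type_synonym ('m, 'e) chart = "'m set \<times> ('m \<Rightarrow> 'e)"

definition chart_inv :: "('m, 'e) chart \<Rightarrow> 'e \<Rightarrow> 'm" where
  "chart_inv c = inv_into (fst c) (snd c)"

definition is_chart :: "('m::topological_space, 'e::euclidean_space) chart \<Rightarrow> bool" where
  "is_chart c \<longleftrightarrow>
     open (fst c) \<and> open (snd c ` fst c) \<and>
     homeomorphism (fst c) (snd c ` fst c) (snd c) (chart_inv c)"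

definition smooth_atlas ::
  "('m::{t2_space, second_countable_topology}, 'e::euclidean_space) chart set \<Rightarrow> bool" where
  "smooth_atlas A \<longleftrightarrow>
     (\<forall>c\<in>A. is_chart c) \<and> (\<Union>c\<in>A. fst c) = UNIV \<and>
     (\<forall>c\<in>A. \<forall>d\<in>A. smooth_on (snd c ` (fst c \<inter> fst d)) (snd d \<circ> chart_inv c))"

definition prod_atlas :: "('m, 'e) chart set \<Rightarrow> ('n, 'f) chart set \<Rightarrow> ('m \<times> 'n, 'e \<times> 'f) chart set" where
  "prod_atlas A B = (\<lambda>(c, d). (fst c \<times> fst d, map_prod (snd c) (snd d))) ` (A \<times> B)"

definition euclidean_atlas :: "('e, 'e) chart set" where
  "euclidean_atlas = {(UNIV, id)}"

definition smooth_map ::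
  "('m::topological_space, 'e::euclidean_space) chart set \<Rightarrow>
   ('n::topological_space, 'f::euclidean_space) chart set \<Rightarrow> ('m \<Rightarrow> 'n) \<Rightarrow> bool" where
  "smooth_map A B F \<longleftrightarrow>
     continuous_on UNIV F \<and>
     (\<forall>c\<in>A. \<forall>d\<in>B. smooth_on (snd c ` (fst c \<inter> F -` fst d)) (snd d \<circ> F \<circ> chart_inv c))"

abbreviation smooth_fun :: "('m::topological_space, 'e::euclidean_space) chart set \<Rightarrow> ('m \<Rightarrow> real) \<Rightarrow> bool" where
  "smooth_fun A \<equiv> smooth_map A euclidean_atlas"


section \<open>Tangent vectors and vector fields\<close>

text \<open>
  The tangent space at \<open>p\<close> is a copy of the model space \<open>'e\<close>: a tangent vector at \<open>p\<close> is given by its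
  components in the chart \<open>chart_at A p\<close>, chosen once and for all for each \<open>p\<close>. As that choice need
  not vary continuously with \<open>p\<close>, a vector field \<open>X :: 'm \<Rightarrow> 'e\<close> is smooth when its components
  with respect to each fixed chart are smooth, not when \<open>X\<close> itself is.
\<close>

definition chart_at :: "('m, 'e) chart set \<Rightarrow> 'm \<Rightarrow> ('m, 'e) chart" where
  "chart_at A p = (SOME c. c \<in> A \<and> p \<in> fst c)"

definition tangent_map ::
  "('m, 'e::euclidean_space) chart set \<Rightarrow> ('n, 'f::euclidean_space) chart set \<Rightarrow>
   ('m \<Rightarrow> 'n) \<Rightarrow> 'm \<Rightarrow> 'e \<Rightarrow> 'f" where
  "tangent_map A B F p =
     frechet_derivative (snd (chart_at B (F p)) \<circ> F \<circ> chart_inv (chart_at A p))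
       (at (snd (chart_at A p) p))"

definition components ::
  "('m, 'e::euclidean_space) chart set \<Rightarrow> ('m, 'e) chart \<Rightarrow> ('m \<Rightarrow> 'e) \<Rightarrow> 'e \<Rightarrow> 'e" where
  "components A c X x =
     (let p = chart_inv c x; d = chart_at A p
      in frechet_derivative (snd c \<circ> chart_inv d) (at (snd d p)) (X p))"

definition smooth_field :: "('m, 'e::euclidean_space) chart set \<Rightarrow> ('m \<Rightarrow> 'e) \<Rightarrow> bool" where
  "smooth_field A X \<longleftrightarrow> (\<forall>c\<in>A. smooth_on (snd c ` fst c) (components A c X))"

definition field_deriv :: "('m, 'e::euclidean_space) chart set \<Rightarrow> ('m \<Rightarrow> 'e) \<Rightarrow> ('m \<Rightarrow> real) \<Rightarrow> 'm \<Rightarrow> real" where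
  "field_deriv A X f p = tangent_map A euclidean_atlas f p (X p)"

text \<open>
  The coordinate formula \<open>[X,Y]\<^sup>i = X\<^sup>j \<partial>\<^sub>j Y\<^sup>i - Y\<^sup>j \<partial>\<^sub>j X\<^sup>i\<close>, evaluated at \<open>p\<close> in the chart in which
  tangent vectors at \<open>p\<close> are expressed.
\<close>

definition lie_bracket ::
  "('m, 'e::euclidean_space) chart set \<Rightarrow> ('m \<Rightarrow> 'e) \<Rightarrow> ('m \<Rightarrow> 'e) \<Rightarrow> 'm \<Rightarrow> 'e" where
  "lie_bracket A X Y p =
     (let c = chart_at A p; x = snd c p
      in frechet_derivative (components A c Y) (at x) (X p)
       - frechet_derivative (components A c X) (at x) (Y p))"


section \<open>Pseudo-Riemannian metrics\<close>

definition pseudo_riemannian_metric ::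
  "('m::topological_space, 'e::euclidean_space) chart set \<Rightarrow> ('m \<Rightarrow> 'e \<Rightarrow> 'e \<Rightarrow> real) \<Rightarrow> bool" where
  "pseudo_riemannian_metric A g \<longleftrightarrow>
     (\<forall>p. bilinear (g p)) \<and>
     (\<forall>p v w. g p v w = g p w v) \<and>
     (\<forall>p v. (\<forall>w. g p v w = 0) \<longrightarrow> v = 0) \<and>
     (\<forall>X Y. smooth_field A X \<longrightarrow> smooth_field A Y \<longrightarrow> smooth_fun A (\<lambda>p. g p (X p) (Y p)))"

definition affine_connection ::
  "('m::topological_space, 'e::euclidean_space) chart set \<Rightarrow>
   (('m \<Rightarrow> 'e) \<Rightarrow> ('m \<Rightarrow> 'e) \<Rightarrow> ('m \<Rightarrow> 'e)) \<Rightarrow> bool" where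
  "affine_connection A D \<longleftrightarrow>
     (\<forall>X Y. smooth_field A X \<longrightarrow> smooth_field A Y \<longrightarrow> smooth_field A (D X Y)) \<and>
     (\<forall>X Y Z. smooth_field A X \<longrightarrow> smooth_field A Y \<longrightarrow> smooth_field A Z \<longrightarrow>
        D (\<lambda>p. X p + Y p) Z = (\<lambda>p. D X Z p + D Y Z p) \<and>
        D X (\<lambda>p. Y p + Z p) = (\<lambda>p. D X Y p + D X Z p)) \<and>
     (\<forall>f X Y. smooth_fun A f \<longrightarrow> smooth_field A X \<longrightarrow> smooth_field A Y \<longrightarrow>
        D (\<lambda>p. f p *\<^sub>R X p) Y = (\<lambda>p. f p *\<^sub>R D X Y p) \<and>
        D X (\<lambda>p. f p *\<^sub>R Y p) = (\<lambda>p. field_deriv A X f p *\<^sub>R Y p + f p *\<^sub>R D X Y p))"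

definition torsion_free ::
  "('m, 'e::euclidean_space) chart set \<Rightarrow> (('m \<Rightarrow> 'e) \<Rightarrow> ('m \<Rightarrow> 'e) \<Rightarrow> ('m \<Rightarrow> 'e)) \<Rightarrow> bool" where
  "torsion_free A D \<longleftrightarrow>
     (\<forall>X Y. smooth_field A X \<longrightarrow> smooth_field A Y \<longrightarrow>
        (\<forall>p. D X Y p - D Y X p = lie_bracket A X Y p))"

definition metric_compatible ::
  "('m, 'e::euclidean_space) chart set \<Rightarrow> ('m \<Rightarrow> 'e \<Rightarrow> 'e \<Rightarrow> real) \<Rightarrow>
   (('m \<Rightarrow> 'e) \<Rightarrow> ('m \<Rightarrow> 'e) \<Rightarrow> ('m \<Rightarrow> 'e)) \<Rightarrow> bool" where
  "metric_compatible A g D \<longleftrightarrow>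
     (\<forall>X Y Z. smooth_field A X \<longrightarrow> smooth_field A Y \<longrightarrow> smooth_field A Z \<longrightarrow>
        (\<forall>p. field_deriv A X (\<lambda>q. g q (Y q) (Z q)) p = g p (D X Y p) (Z p) + g p (Y p) (D X Z p)))"

definition levi_civita ::
  "('m::topological_space, 'e::euclidean_space) chart set \<Rightarrow> ('m \<Rightarrow> 'e \<Rightarrow> 'e \<Rightarrow> real) \<Rightarrow>
   (('m \<Rightarrow> 'e) \<Rightarrow> ('m \<Rightarrow> 'e) \<Rightarrow> ('m \<Rightarrow> 'e)) \<Rightarrow> bool" where
  "levi_civita A g D \<longleftrightarrow> affine_connection A D \<and> torsion_free A D \<and> metric_compatible A g D"

definition curvature ::
  "('m, 'e::euclidean_space) chart set \<Rightarrow> (('m \<Rightarrow> 'e) \<Rightarrow> ('m \<Rightarrow> 'e) \<Rightarrow> ('m \<Rightarrow> 'e)) \<Rightarrow>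
   ('m \<Rightarrow> 'e) \<Rightarrow> ('m \<Rightarrow> 'e) \<Rightarrow> ('m \<Rightarrow> 'e) \<Rightarrow> 'm \<Rightarrow> 'e" where
  "curvature A D X Y Z p = D X (D Y Z) p - D Y (D X Z) p - D (lie_bracket A X Y) Z p"

text \<open>
  As functions on all of \<open>'m \<Rightarrow> 'e\<close>, Levi-Civita connections differ in their irrelevant values on
  non-smooth fields. On smooth fields the Levi-Civita connection exists and is unique, so it makes
  no difference whether one asks for a property of some or of all \<open>D\<close> with \<open>levi_civita A g D\<close>.
  We choose the reading that does not become trivially true in the absence of any such \<open>D\<close> when it
  is a hypothesis (\<open>anti_kaehler\<close> below), and the universal one when it is a conclusion (\<open>flat\<close>).
\<close>

definition flat ::
  "('m::topological_space, 'e::euclidean_space) chart set \<Rightarrow> ('m \<Rightarrow> 'e \<Rightarrow> 'e \<Rightarrow> real) \<Rightarrow> bool" where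
  "flat A g \<longleftrightarrow>
     (\<forall>D. levi_civita A g D \<longrightarrow>
        (\<forall>X Y Z. smooth_field A X \<longrightarrow> smooth_field A Y \<longrightarrow> smooth_field A Z \<longrightarrow>
           (\<forall>p. curvature A D X Y Z p = 0)))"


section \<open>Anti-Kaehler structures\<close>

definition almost_complex_structure ::
  "('m, 'e::euclidean_space) chart set \<Rightarrow> ('m \<Rightarrow> 'e \<Rightarrow> 'e) \<Rightarrow> bool" where
  "almost_complex_structure A J \<longleftrightarrow>
     (\<forall>p. linear (J p)) \<and> (\<forall>p v. J p (J p v) = - v) \<and>
     (\<forall>X. smooth_field A X \<longrightarrow> smooth_field A (\<lambda>p. J p (X p)))"

definition parallel ::
  "('m, 'e::euclidean_space) chart set \<Rightarrow> (('m \<Rightarrow> 'e) \<Rightarrow> ('m \<Rightarrow> 'e) \<Rightarrow> ('m \<Rightarrow> 'e)) \<Rightarrow>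
   ('m \<Rightarrow> 'e \<Rightarrow> 'e) \<Rightarrow> bool" where
  "parallel A D J \<longleftrightarrow>
     (\<forall>X Y. smooth_field A X \<longrightarrow> smooth_field A Y \<longrightarrow>
        (\<forall>p. D X (\<lambda>q. J q (Y q)) p = J p (D X Y p)))"

definition anti_kaehler ::
  "('m::topological_space, 'e::euclidean_space) chart set \<Rightarrow> ('m \<Rightarrow> 'e \<Rightarrow> 'e \<Rightarrow> real) \<Rightarrow>
   ('m \<Rightarrow> 'e \<Rightarrow> 'e) \<Rightarrow> bool" where
  "anti_kaehler A g J \<longleftrightarrow>
     pseudo_riemannian_metric A g \<and> almost_complex_structure A J \<and>
     (\<forall>p v w. g p (J p v) (J p w) = - g p v w) \<and>
     (\<exists>D. levi_civita A g D \<and> parallel A D J)"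


section \<open>Lie groups and left invariant structures\<close>

text \<open>
  The group is written additively because \<open>group_add\<close> is the type class of groups; it is not assumed
  to be commutative.
\<close>

definition lie_group ::
  "('g::{group_add, t2_space, second_countable_topology}, 'e::euclidean_space) chart set \<Rightarrow> bool" where
  "lie_group A \<longleftrightarrow>
     smooth_atlas A \<and>
     smooth_map (prod_atlas A A) A (\<lambda>(a, b). a + b) \<and>
     smooth_map A A (\<lambda>a. - a)"

abbreviation left_translation ::
  "('g::group_add, 'e::euclidean_space) chart set \<Rightarrow> 'g \<Rightarrow> 'g \<Rightarrow> 'e \<Rightarrow> 'e" where
  "left_translation A a \<equiv> tangent_map A A (\<lambda>p. a + p)"

definition lie_algebra :: "('g::group_add, 'e::euclidean_space) chart set \<Rightarrow> ('g \<Rightarrow> 'e) set" where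
  "lie_algebra A =
     {X. smooth_field A X \<and> (\<forall>a p. left_translation A a p (X p) = X (a + p))}"

definition left_invariant_metric ::
  "('g::group_add, 'e::euclidean_space) chart set \<Rightarrow> ('g \<Rightarrow> 'e \<Rightarrow> 'e \<Rightarrow> real) \<Rightarrow> bool" where
  "left_invariant_metric A g \<longleftrightarrow>
     (\<forall>a p v w. g (a + p) (left_translation A a p v) (left_translation A a p w) = g p v w)"

definition left_invariant_endomorphism ::
  "('g::group_add, 'e::euclidean_space) chart set \<Rightarrow> ('g \<Rightarrow> 'e \<Rightarrow> 'e) \<Rightarrow> bool" where
  "left_invariant_endomorphism A J \<longleftrightarrow>
     (\<forall>a p v. J (a + p) (left_translation A a p v) = left_translation A a p (J p v))"

definition left_invariant_anti_kaehler ::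
  "('g::{group_add, topological_space}, 'e::euclidean_space) chart set \<Rightarrow>
   ('g \<Rightarrow> 'e \<Rightarrow> 'e \<Rightarrow> real) \<Rightarrow> ('g \<Rightarrow> 'e \<Rightarrow> 'e) \<Rightarrow> bool" where
  "left_invariant_anti_kaehler A g J \<longleftrightarrow>
     anti_kaehler A g J \<and> left_invariant_metric A g \<and> left_invariant_endomorphism A J"

definition abelian_complex_structure ::
  "('g::group_add, 'e::euclidean_space) chart set \<Rightarrow> ('g \<Rightarrow> 'e \<Rightarrow> 'e) \<Rightarrow> bool" where
  "abelian_complex_structure A J \<longleftrightarrow>
     (\<forall>X\<in>lie_algebra A. \<forall>Y\<in>lie_algebra A.
        lie_bracket A (\<lambda>p. J p (X p)) (\<lambda>p. J p (Y p)) = lie_bracket A X Y)"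

end

theory Submission
  imports Defs
begin

text \<open>
  Identify the Lie algebra with the tangent space at the identity and write \<open>u \<cdot> v\<close> for the covariant
  derivative of left invariant fields. The tensor \<open>T(u, v) = (J u) \<cdot> v + J (u \<cdot> v)\<close> is symmetric because \<open>J\<close>
  is abelian and parallel, and \<open>T(u, -)\<close> is skew for the metric because \<open>J\<close> is self-adjoint; hence
  \<open>T = 0\<close>. Consequently \<open>[J u \<cdot>, J v \<cdot>] = - [u \<cdot>, v \<cdot>]\<close>, while pair symmetry of the curvature gives
  \<open>R(J u, J v) = - R(u, v)\<close>; comparing the two, \<open>[u, v] \<cdot> w = 0\<close> and \<open>R(J u, v) = - J R(u, v)\<close>. The last
  identity and the first Bianchi identity force \<open>R = 0\<close>.

  Left invariant fields form a global frame in which the coefficients of a smooth field are smooth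
  (they are inner products with the dual left invariant frame), so by tensoriality it suffices to
  know the curvature on left invariant fields. The only input from calculus on the manifold is the
  naturality of the Lie bracket and the Jacobi identity.
\<close>

section \<open>Calculus of smooth maps and vector fields on Euclidean spaces\<close>

abbreviation dd :: "('a::euclidean_space \<Rightarrow> 'b::euclidean_space) \<Rightarrow> 'a \<Rightarrow> 'a \<Rightarrow> 'b" where
  "dd f x \<equiv> frechet_derivative f (at x)"

section \<open>Locality and closure properties of C^k maps\<close>

lemma differentiable_cong_open:
  assumes "open S" "x \<in> S" "\<And>y. y \<in> S \<Longrightarrow> f y = g y" "f differentiable (at x)"
  shows "g differentiable (at x)"
  using assms has_derivative_transform_within_open[of f _ x UNIV S g]
  unfolding differentiable_def by blast

lemma frechet_derivative_cong_open:
  assumes "open S" "x \<in> S" "\<And>y. y \<in> S \<Longrightarrow> f y = g y"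
  shows "frechet_derivative f (at x) = frechet_derivative g (at x)"
proof -
  have "(f has_derivative f') (at x) \<longleftrightarrow> (g has_derivative f') (at x)" for f'
    using has_derivative_transform_within_open[of f f' x UNIV S g]
      has_derivative_transform_within_open[of g f' x UNIV S f] assms by auto
  then show ?thesis
    unfolding frechet_derivative_def by simp
qed

lemma Ck_on_cong:
  assumes "open S" "\<And>x. x \<in> S \<Longrightarrow> f x = g x" "Ck_on k S f"
  shows "Ck_on k S g"
  using assms(2,3)
proof (induction k arbitrary: f g)
  case 0
  then show ?case
    using continuous_on_cong[of S S f g] by simp
next
  case (Suc k)
  have "g differentiable (at x)" if "x \<in> S" for x
    using differentiable_cong_open[of S x f g] assms(1) Suc.prems that by auto
  moreover have "Ck_on k S (\<lambda>x. dd g x v)" for v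
  proof (rule Suc.IH[of "\<lambda>x. dd f x v"])
    show "dd f x v = dd g x v" if "x \<in> S" for x
      using frechet_derivative_cong_open[of S x f g] assms(1) Suc.prems(1) that by auto
    show "Ck_on k S (\<lambda>x. dd f x v)"
      using Suc.prems(2) by simp
  qed
  ultimately show ?case by simp
qed

text \<open>Of \<open>f\<close> itself \<open>Ck_on (Suc k)\<close> asks only differentiability, so
  the inclusion is an induction; its base case is the continuity of differentiable maps.\<close>

lemma Ck_on_Suc_imp_Ck_on: "Ck_on (Suc k) S f \<Longrightarrow> Ck_on k S f"
proof (induction k arbitrary: f)
  case 0
  then show ?case
    by (auto intro!: continuous_at_imp_continuous_on differentiable_imp_continuous_within)
next
  case (Suc k)
  then show ?case by (metis Ck_on.simps(2))
qed

lemma Ck_on_subset: "Ck_on k S f \<Longrightarrow> T \<subseteq> S \<Longrightarrow> Ck_on k T f"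
  by (induction k arbitrary: f) (auto intro: continuous_on_subset)

lemma Ck_on_const: "Ck_on k S (\<lambda>x. c)"
  by (induction k arbitrary: c) auto

lemma Ck_on_add:
  assumes "open S"
  shows "Ck_on k S f \<Longrightarrow> Ck_on k S g \<Longrightarrow> Ck_on k S (\<lambda>x. f x + g x)"
proof (induction k arbitrary: f g)
  case 0
  then show ?case by (auto intro: continuous_intros)
next
  case (Suc k)
  have *: "((\<lambda>x. f x + g x) has_derivative (\<lambda>v. dd f x v + dd g x v)) (at x)" if "x \<in> S" for x
    using Suc.prems that
    by (auto intro!: has_derivative_add simp: frechet_derivative_works[symmetric])
  have "Ck_on k S (\<lambda>x. dd (\<lambda>x. f x + g x) x v)" for v
    by (rule Ck_on_cong[OF assms _ Suc.IH[of "\<lambda>x. dd f x v" "\<lambda>x. dd g x v"]])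
      (use Suc.prems frechet_derivative_at[OF *] in \<open>auto dest: fun_cong\<close>)
  then show ?case
    using * by (auto simp: differentiable_def)
qed

lemma Ck_on_scaleR:
  fixes f :: "'a::euclidean_space \<Rightarrow> real" and g :: "'a \<Rightarrow> 'b::euclidean_space"
  assumes "open S"
  shows "Ck_on k S f \<Longrightarrow> Ck_on k S g \<Longrightarrow> Ck_on k S (\<lambda>x. f x *\<^sub>R g x)"
proof (induction k arbitrary: f g)
  case 0
  then show ?case by (auto intro: continuous_intros)
next
  case (Suc k)
  have *: "((\<lambda>x. f x *\<^sub>R g x) has_derivative (\<lambda>v. f x *\<^sub>R dd g x v + dd f x v *\<^sub>R g x)) (at x)"
    if "x \<in> S" for x
    using Suc.prems that
    by (auto intro!: has_derivative_scaleR simp: frechet_derivative_works[symmetric])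
  have "Ck_on k S (\<lambda>x. dd (\<lambda>x. f x *\<^sub>R g x) x v)" for v
  proof (rule Ck_on_cong[OF assms])
    show "Ck_on k S (\<lambda>x. f x *\<^sub>R dd g x v + dd f x v *\<^sub>R g x)"
      using Suc.prems Suc.prems[THEN Ck_on_Suc_imp_Ck_on]
      by (intro Ck_on_add[OF assms] Suc.IH) auto
  qed (use frechet_derivative_at[OF *] in \<open>auto dest: fun_cong\<close>)
  then show ?case
    using * by (auto simp: differentiable_def)
qed

text \<open>Fixing one factor of the group law in charts is a precomposition with an affine map. The
  derivative of the composite in direction \<open>v\<close> is the derivative of \<open>f\<close> in
  direction \<open>L v\<close>, precomposed with the same affine map, so the induction
  closes.\<close>

lemma Ck_on_compose_affine:
  fixes f :: "'b::euclidean_space \<Rightarrow> 'c::euclidean_space" and L :: "'a::euclidean_space \<Rightarrow> 'b"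
  assumes "open S" "linear L"
  shows "Ck_on k S f \<Longrightarrow> Ck_on k ((\<lambda>x. a + L x) -` S) (\<lambda>x. f (a + L x))"
proof (induction k arbitrary: f)
  case 0
  then show ?case
    using assms(2) linear_continuous_on[of L "(\<lambda>x. a + L x) -` S"]
    by (auto intro!: continuous_on_compose2[of S f _ "\<lambda>x. a + L x"] continuous_on_add
        simp: linear_conv_bounded_linear)
next
  case (Suc k)
  have L: "((\<lambda>x. a + L x) has_derivative L) (at x)" for x
    using assms(2) by (auto intro!: derivative_eq_intros bounded_linear_imp_has_derivative simp: linear_conv_bounded_linear)
  have *: "((\<lambda>x. f (a + L x)) has_derivative (\<lambda>v. dd f (a + L x) (L v))) (at x)"
    if "x \<in> (\<lambda>x. a + L x) -` S" for x
    using Suc.prems that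
    by (intro has_derivative_compose[OF L]) (auto simp: frechet_derivative_works[symmetric])
  have "open ((\<lambda>x. a + L x) -` S)"
    using L by (intro continuous_open_vimage assms(1)) (blast intro: has_derivative_continuous)
  then have "Ck_on k ((\<lambda>x. a + L x) -` S) (\<lambda>x. dd (\<lambda>x. f (a + L x)) x v)" for v
  proof (rule Ck_on_cong)
    show "dd f (a + L x) (L v) = dd (\<lambda>x. f (a + L x)) x v" if "x \<in> (\<lambda>x. a + L x) -` S" for x
      using fun_cong[OF frechet_derivative_at[OF *[OF that]]] .
    show "Ck_on k ((\<lambda>x. a + L x) -` S) (\<lambda>x. dd f (a + L x) (L v))"
      using Suc.IH[of "\<lambda>x. dd f x (L v)"] Suc.prems by simp
  qed
  then show ?case
    using * by (auto simp: differentiable_def)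
qed

lemma smooth_on_cong:
  "open S \<Longrightarrow> (\<And>x. x \<in> S \<Longrightarrow> f x = g x) \<Longrightarrow> smooth_on S f \<Longrightarrow> smooth_on S g"
  unfolding smooth_on_def using Ck_on_cong by blast

lemma smooth_on_subset: "smooth_on S f \<Longrightarrow> T \<subseteq> S \<Longrightarrow> smooth_on T f"
  unfolding smooth_on_def using Ck_on_subset by blast

lemma smooth_on_const: "smooth_on S (\<lambda>x. c)"
  unfolding smooth_on_def using Ck_on_const by blast

lemma smooth_on_add:
  "open S \<Longrightarrow> smooth_on S f \<Longrightarrow> smooth_on S g \<Longrightarrow> smooth_on S (\<lambda>x. f x + g x)"
  unfolding smooth_on_def using Ck_on_add by blast

lemma smooth_on_scaleR:
  fixes f :: "'a::euclidean_space \<Rightarrow> real" and g :: "'a \<Rightarrow> 'b::euclidean_space"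
  shows "open S \<Longrightarrow> smooth_on S f \<Longrightarrow> smooth_on S g \<Longrightarrow> smooth_on S (\<lambda>x. f x *\<^sub>R g x)"
  unfolding smooth_on_def using Ck_on_scaleR by blast

lemma smooth_on_compose_affine:
  fixes f :: "'b::euclidean_space \<Rightarrow> 'c::euclidean_space" and L :: "'a::euclidean_space \<Rightarrow> 'b"
  assumes "open S" "linear L" "smooth_on S f"
  shows "smooth_on ((\<lambda>x. a + L x) -` S) (\<lambda>x. f (a + L x))"
  using assms Ck_on_compose_affine unfolding smooth_on_def by blast

lemma smooth_on_imp_differentiable: "smooth_on S f \<Longrightarrow> x \<in> S \<Longrightarrow> f differentiable (at x)"
  unfolding smooth_on_def by (metis Ck_on.simps(2))

lemma smooth_on_imp_continuous_on: "smooth_on S f \<Longrightarrow> continuous_on S f"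
  unfolding smooth_on_def by (metis Ck_on.simps(1))

lemma smooth_on_frechet_derivative:
  "smooth_on S f \<Longrightarrow> smooth_on S (\<lambda>x. frechet_derivative f (at x) v)"
  unfolding smooth_on_def by (metis Ck_on.simps(2))

lemma smooth_on_has_derivative:
  "smooth_on S f \<Longrightarrow> x \<in> S \<Longrightarrow> (f has_derivative frechet_derivative f (at x)) (at x)"
  using smooth_on_imp_differentiable frechet_derivative_works by blast

section \<open>Symmetry of second derivatives\<close>

lemma second_difference_MVT:
  fixes f :: "'a::euclidean_space \<Rightarrow> real"
  assumes S: "smooth_on S f" and t: "t > 0"
    and mem: "\<And>r s. 0 \<le> r \<Longrightarrow> r \<le> t \<Longrightarrow> 0 \<le> s \<Longrightarrow> s \<le> t \<Longrightarrow> x + r *\<^sub>R u + s *\<^sub>R v \<in> S"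
  obtains r s where "0 < r" "r < t" "0 < s" "s < t"
    "f (x + t *\<^sub>R u + t *\<^sub>R v) - f (x + t *\<^sub>R u) - f (x + t *\<^sub>R v) + f x =
      t * (t * dd (\<lambda>y. dd f y u) (x + r *\<^sub>R u + s *\<^sub>R v) v)"
proof -
  have line: "DERIV (\<lambda>s. h (y + s *\<^sub>R w)) s :> dd h (y + s *\<^sub>R w) w"
    if "smooth_on S h" "y + s *\<^sub>R w \<in> S" for h :: "'a \<Rightarrow> real" and y w s
  proof -
    have "((\<lambda>s. y + s *\<^sub>R w) has_derivative (\<lambda>d. d *\<^sub>R w)) (at s)"
      by (auto intro!: derivative_eq_intros)
    from has_derivative_compose[OF this smooth_on_has_derivative[OF that]]
    have "((\<lambda>s. h (y + s *\<^sub>R w)) has_derivative (\<lambda>d. dd h (y + s *\<^sub>R w) (d *\<^sub>R w))) (at s)" .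
    moreover have "(\<lambda>d. dd h (y + s *\<^sub>R w) (d *\<^sub>R w)) = (*) (dd h (y + s *\<^sub>R w) w)"
      using linear_frechet_derivative[OF smooth_on_imp_differentiable[OF that]]
      by (auto simp: linear_cmul mult.commute)
    ultimately show ?thesis
      by (simp add: has_field_derivative_def)
  qed
  \<comment> \<open>\<open>\<phi> r\<close> is the increment of \<open>f\<close> along
    \<open>t *\<^sub>R v\<close> from the base point \<open>x + r *\<^sub>R u\<close>, so the second
    difference is \<open>\<phi> t - \<phi> 0\<close>. The mean value theorem in \<open>r\<close>,
    and then in \<open>s\<close> for the directional derivative, produces the mixed
    derivative.\<close>
  define \<phi> where "\<phi> r = f ((x + t *\<^sub>R v) + r *\<^sub>R u) - f (x + r *\<^sub>R u)" for r
  have "DERIV \<phi> r :> dd f ((x + t *\<^sub>R v) + r *\<^sub>R u) u - dd f (x + r *\<^sub>R u) u"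
    if "0 \<le> r" "r \<le> t" for r
    unfolding \<phi>_def using mem[of r t] mem[of r 0] that t
    by (intro DERIV_diff line S) (auto simp: algebra_simps)
  from MVT2[OF t this] obtain r where r: "0 < r" "r < t"
    "\<phi> t - \<phi> 0 = t * (dd f ((x + t *\<^sub>R v) + r *\<^sub>R u) u - dd f (x + r *\<^sub>R u) u)"
    by auto
  have "DERIV (\<lambda>s. dd f ((x + r *\<^sub>R u) + s *\<^sub>R v) u) s :>
      dd (\<lambda>y. dd f y u) ((x + r *\<^sub>R u) + s *\<^sub>R v) v"
    if "0 \<le> s" "s \<le> t" for s
    using mem[of r s] r that by (intro line smooth_on_frechet_derivative S) auto
  from MVT2[OF t this] obtain s where s: "0 < s" "s < t"
    "dd f ((x + r *\<^sub>R u) + t *\<^sub>R v) u - dd f (x + r *\<^sub>R u) u =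
      t * dd (\<lambda>y. dd f y u) (x + r *\<^sub>R u + s *\<^sub>R v) v"
    by auto
  show thesis
    using r s by (intro that[of r s]) (auto simp: \<phi>_def add_ac diff_diff_add algebra_simps)
qed

text \<open>The second difference is symmetric in \<open>u\<close> and \<open>v\<close>. Hence the
  mixed derivative in one order, at some point near \<open>x\<close>, equals the one in the other
  order at another point near \<open>x\<close>; continuity concludes.\<close>

lemma second_derivative_symmetric_real:
  fixes f :: "'a::euclidean_space \<Rightarrow> real"
  assumes S: "open S" "smooth_on S f" "x \<in> S"
  shows "dd (\<lambda>y. dd f y u) x v = dd (\<lambda>y. dd f y v) x u"
proof (rule ccontr)
  define G where "G = (\<lambda>y. dd (\<lambda>y. dd f y u) y v - dd (\<lambda>y. dd f y v) y u)"
  assume "\<not> ?thesis"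
  then have "G x \<noteq> 0" by (simp add: G_def)
  have contuv: "continuous_on S (\<lambda>y. dd (\<lambda>y. dd f y u) y v)" for u v
    by (intro smooth_on_imp_continuous_on smooth_on_frechet_derivative S)
  \<comment> \<open>Each mixed derivative moves by less than \<open>e\<close> between
    \<open>x\<close> and its nearby point, so the two together account for less than
    \<open>2 * e\<close>, which is the absolute value of \<open>G x\<close>.\<close>
  define e where "e = \<bar>G x\<bar> / 2"
  have "e > 0" using \<open>G x \<noteq> 0\<close> by (simp add: e_def)
  obtain d0 where d0: "d0 > 0" "ball x d0 \<subseteq> S"
    using S openE by blast
  obtain d1 where d1: "d1 > 0"
    "\<And>y. y \<in> S \<Longrightarrow> dist y x < d1 \<Longrightarrow> dist (dd (\<lambda>y. dd f y u) y v) (dd (\<lambda>y. dd f y u) x v) < e"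
    using contuv[of u v] S(3) \<open>e > 0\<close> unfolding continuous_on_iff by metis
  obtain d2 where d2: "d2 > 0"
    "\<And>y. y \<in> S \<Longrightarrow> dist y x < d2 \<Longrightarrow> dist (dd (\<lambda>y. dd f y v) y u) (dd (\<lambda>y. dd f y v) x u) < e"
    using contuv[of v u] S(3) \<open>e > 0\<close> unfolding continuous_on_iff by metis
  define d where "d = min d0 (min d1 d2)"
  \<comment> \<open>Chosen so that the parallelogram at \<open>x\<close> spanned by
    \<open>t *\<^sub>R u\<close> and \<open>t *\<^sub>R v\<close> stays within distance
    \<open>d\<close>; the summand 1 keeps the denominator positive when \<open>u\<close> and
    \<open>v\<close> vanish.\<close>
  define t where "t = d / (2 * (norm u + norm v + 1))"
  have "d > 0" using d0 d1 d2 by (simp add: d_def)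
  have np: "0 < norm u + norm v + 1"
    by (smt (verit) norm_ge_zero)
  have "t > 0" using \<open>d > 0\<close> np by (simp add: t_def)
  have "t * (norm u + norm v) < d"
  proof -
    have "t * (norm u + norm v) \<le> t * (norm u + norm v + 1)"
      using \<open>t > 0\<close> by simp
    also have "\<dots> = d / 2" using np by (simp add: t_def field_simps)
    finally show ?thesis using \<open>d > 0\<close> by linarith
  qed
  have near: "dist (x + r *\<^sub>R u + s *\<^sub>R v) x < d" if "0 \<le> r" "r \<le> t" "0 \<le> s" "s \<le> t" for r s
  proof -
    have "dist (x + r *\<^sub>R u + s *\<^sub>R v) x = norm (r *\<^sub>R u + s *\<^sub>R v)"
      by (simp add: dist_norm algebra_simps)
    also have "\<dots> \<le> r * norm u + s * norm v"
      using that by (intro norm_triangle_le) simp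
    also have "\<dots> \<le> t * norm u + t * norm v"
      using that by (intro add_mono mult_right_mono) auto
    finally show ?thesis
      using \<open>t * (norm u + norm v) < d\<close> by (simp add: algebra_simps)
  qed
  have inS: "y \<in> S" if "dist y x < d" for y
    using that d0 by (auto simp: d_def dist_commute subset_eq)
  have near': "dist (x + r *\<^sub>R v + s *\<^sub>R u) x < d" if "0 \<le> r" "r \<le> t" "0 \<le> s" "s \<le> t" for r s
    using near[OF that(3,4,1,2)] by (simp add: add_ac)
  obtain r s where rs: "0 < r" "r < t" "0 < s" "s < t"
    "f (x + t *\<^sub>R u + t *\<^sub>R v) - f (x + t *\<^sub>R u) - f (x + t *\<^sub>R v) + f x =
      t * (t * dd (\<lambda>y. dd f y u) (x + r *\<^sub>R u + s *\<^sub>R v) v)"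
    using second_difference_MVT[OF S(2) \<open>t > 0\<close>, of x u v] near inS by metis
  obtain r' s' where rs': "0 < r'" "r' < t" "0 < s'" "s' < t"
    "f (x + t *\<^sub>R v + t *\<^sub>R u) - f (x + t *\<^sub>R v) - f (x + t *\<^sub>R u) + f x =
      t * (t * dd (\<lambda>y. dd f y v) (x + r' *\<^sub>R v + s' *\<^sub>R u) u)"
    using second_difference_MVT[OF S(2) \<open>t > 0\<close>, of x v u] near' inS by metis
  let ?y = "x + r *\<^sub>R u + s *\<^sub>R v" and ?z = "x + s' *\<^sub>R u + r' *\<^sub>R v"
  have z: "x + r' *\<^sub>R v + s' *\<^sub>R u = ?z"
    "x + t *\<^sub>R v + t *\<^sub>R u = x + t *\<^sub>R u + t *\<^sub>R v"
    by simp_all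
  have "t * (t * dd (\<lambda>y. dd f y u) ?y v) = t * (t * dd (\<lambda>y. dd f y v) ?z u)"
    using rs(5) rs'(5) unfolding z by linarith
  then have eq: "dd (\<lambda>y. dd f y u) ?y v = dd (\<lambda>y. dd f y v) ?z u"
    using \<open>t > 0\<close> by simp
  have "dist ?y x < d" "dist ?z x < d"
    using rs rs' by (auto intro!: near)
  then have "dist (dd (\<lambda>y. dd f y u) ?y v) (dd (\<lambda>y. dd f y u) x v) < e"
    "dist (dd (\<lambda>y. dd f y v) ?z u) (dd (\<lambda>y. dd f y v) x u) < e"
    using inS by (auto intro!: d1 d2 simp: d_def)
  then have "\<bar>G x\<bar> < 2 * e"
    using eq unfolding G_def dist_real_def by linarith
  then show False by (simp add: e_def)
qed

lemma frechet_derivative_inner_left: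
  assumes "f differentiable (at x)"
  shows "dd (\<lambda>y. f y \<bullet> b) x v = dd f x v \<bullet> b"
proof -
  have "((\<lambda>y. f y \<bullet> b) has_derivative (\<lambda>v. dd f x v \<bullet> b)) (at x)"
    using assms by (intro has_derivative_inner_left) (simp add: frechet_derivative_works[symmetric])
  then show ?thesis
    using frechet_derivative_at by metis
qed

lemma Ck_on_inner:
  assumes "open S"
  shows "Ck_on k S f \<Longrightarrow> Ck_on k S (\<lambda>x. f x \<bullet> b)"
proof (induction k arbitrary: f)
  case 0
  then show ?case by (auto intro: continuous_intros)
next
  case (Suc k)
  have "Ck_on k S (\<lambda>x. dd (\<lambda>y. f y \<bullet> b) x v)" for v
    by (rule Ck_on_cong[OF assms _ Suc.IH[of "\<lambda>x. dd f x v"]])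
      (use Suc.prems in \<open>auto simp: frechet_derivative_inner_left\<close>)
  then show ?case
    using Suc.prems by auto
qed

text \<open>Inner products with basis vectors commute with differentiation and reduce this to the
  real-valued case.\<close>

lemma second_derivative_symmetric:
  fixes f :: "'a::euclidean_space \<Rightarrow> 'b::euclidean_space"
  assumes S: "open S" "smooth_on S f" "x \<in> S"
  shows "dd (\<lambda>y. dd f y u) x v = dd (\<lambda>y. dd f y v) x u"
proof (rule euclidean_eqI)
  fix b :: 'b
  have sm: "smooth_on S (\<lambda>y. f y \<bullet> b)"
    using S Ck_on_inner unfolding smooth_on_def by blast
  have *: "dd (\<lambda>y. dd (\<lambda>y. f y \<bullet> b) y u) x v = dd (\<lambda>y. dd f y u) x v \<bullet> b" for u v
  proof -
    have "dd (\<lambda>y. dd (\<lambda>y. f y \<bullet> b) y u) x = dd (\<lambda>y. dd f y u \<bullet> b) x"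
      using S by (intro frechet_derivative_cong_open[of S])
        (auto simp: frechet_derivative_inner_left smooth_on_imp_differentiable)
    then show ?thesis
      using S by (simp add: frechet_derivative_inner_left smooth_on_imp_differentiable[OF smooth_on_frechet_derivative[OF S(2)]])
  qed
  show "dd (\<lambda>y. dd f y u) x v \<bullet> b = dd (\<lambda>y. dd f y v) x u \<bullet> b"
    using second_derivative_symmetric_real[OF S(1) sm S(3)] * by metis
qed

section \<open>Product rule for differentials applied to fields, and the bracket on Euclidean
  space\<close>

lemma has_derivative_frechet_derivative_apply:
  assumes "open S" "smooth_on S f" "x \<in> S" "Y differentiable (at x)"
  shows "((\<lambda>y. dd f y (Y y)) has_derivative
    (\<lambda>h. dd (\<lambda>y. dd f y (Y x)) x h + dd f x (dd Y x h))) (at x)"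
proof -
  note S = assms(1-3)
  have lin: "linear (dd f y)" if "y \<in> S" for y
    using that S by (intro linear_frechet_derivative smooth_on_imp_differentiable)
  have expand: "dd f y w = (\<Sum>b\<in>Basis. (w \<bullet> b) *\<^sub>R dd f y b)" if "y \<in> S" for y w
    by (subst euclidean_representation[of w, symmetric])
      (simp only: linear_sum[OF lin[OF that]] linear_cmul[OF lin[OF that]])
  \<comment> \<open>Expanding \<open>Y y\<close> in the basis gives real coefficients times the
    smooth maps \<open>dd f y b\<close>, to which the ordinary product rule applies.\<close>
  let ?g = "\<lambda>y. \<Sum>b\<in>Basis. (Y y \<bullet> b) *\<^sub>R dd f y b"
  let ?g' = "\<lambda>h. \<Sum>b\<in>Basis. (Y x \<bullet> b) *\<^sub>R dd (\<lambda>y. dd f y b) x h + (dd Y x h \<bullet> b) *\<^sub>R dd f x b"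
  have g: "(?g has_derivative ?g') (at x)"
    using S assms(4)
    by (intro has_derivative_sum has_derivative_scaleR has_derivative_inner_left
        smooth_on_has_derivative[OF smooth_on_frechet_derivative])
      (auto simp: frechet_derivative_works[symmetric])
  \<comment> \<open>The same expansion, with the coefficients frozen at \<open>x\<close>, identifies
    the first summand of \<open>?g'\<close>.\<close>
  have "dd (\<lambda>y. dd f y (Y x)) x = (\<lambda>h. \<Sum>b\<in>Basis. (Y x \<bullet> b) *\<^sub>R dd (\<lambda>y. dd f y b) x h)"
  proof (rule frechet_derivative_at[symmetric], rule has_derivative_transform_within_open[OF _ S(1,3)])
    show "((\<lambda>y. \<Sum>b\<in>Basis. (Y x \<bullet> b) *\<^sub>R dd f y b) has_derivative
        (\<lambda>h. \<Sum>b\<in>Basis. (Y x \<bullet> b) *\<^sub>R dd (\<lambda>y. dd f y b) x h)) (at x)"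
      using S by (intro has_derivative_sum has_derivative_scaleR_right
          smooth_on_has_derivative[OF smooth_on_frechet_derivative])
  qed (simp add: expand[symmetric])
  then have "?g' = (\<lambda>h. dd (\<lambda>y. dd f y (Y x)) x h + dd f x (dd Y x h))"
    using S(3) by (simp add: sum.distrib expand[symmetric])
  then show ?thesis
    using has_derivative_transform_within_open[OF g S(1,3)] expand by auto
qed

lemmas frechet_derivative_frechet_derivative_apply =
  frechet_derivative_at[OF has_derivative_frechet_derivative_apply, symmetric]

text \<open>The coordinate formula of \<open>lie_bracket\<close>, kept in one chart so that it can
  be iterated; \<open>lie_bracket\<close> evaluates each point in the chart picked there.\<close>

definition vf_bracket :: "('a::euclidean_space \<Rightarrow> 'a) \<Rightarrow> ('a \<Rightarrow> 'a) \<Rightarrow> 'a \<Rightarrow> 'a" where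
  "vf_bracket X Y x = dd Y x (X x) - dd X x (Y x)"

lemma vf_bracket_cong_open:
  assumes "open S" "x \<in> S" "\<And>y. y \<in> S \<Longrightarrow> X y = X' y" "\<And>y. y \<in> S \<Longrightarrow> Y y = Y' y"
  shows "vf_bracket X Y x = vf_bracket X' Y' x"
  using frechet_derivative_cong_open[of S x X X'] frechet_derivative_cong_open[of S x Y Y'] assms
  by (simp add: vf_bracket_def)

text \<open>Differentiating \<open>Y' (\<phi> y) = dd \<phi> y (Y y)\<close> along \<open>X\<close>
  by the chain and product rules yields the second derivative of \<open>\<phi>\<close> on
  \<open>X x\<close> and \<open>Y x\<close>. This term is symmetric and cancels in the
  bracket.\<close>

lemma vf_bracket_related:
  assumes S: "open S" "smooth_on S \<phi>" "x \<in> S"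
    and diff: "X differentiable (at x)" "Y differentiable (at x)"
      "X' differentiable (at (\<phi> x))" "Y' differentiable (at (\<phi> x))"
    and relX: "\<And>y. y \<in> S \<Longrightarrow> X' (\<phi> y) = dd \<phi> y (X y)"
    and relY: "\<And>y. y \<in> S \<Longrightarrow> Y' (\<phi> y) = dd \<phi> y (Y y)"
  shows "vf_bracket X' Y' (\<phi> x) = dd \<phi> x (vf_bracket X Y x)"
proof -
  have \<phi>: "\<phi> differentiable (at x)"
    using S smooth_on_imp_differentiable by blast
  have *: "dd Y' (\<phi> x) (dd \<phi> x h) = dd (\<lambda>y. dd \<phi> y (Y x)) x h + dd \<phi> x (dd Y x h)"
    if "Y' differentiable (at (\<phi> x))" "Y differentiable (at x)" "\<And>y. y \<in> S \<Longrightarrow> Y' (\<phi> y) = dd \<phi> y (Y y)"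
    for Y' Y h
  proof -
    have "dd Y' (\<phi> x) (dd \<phi> x h) = dd (Y' \<circ> \<phi>) x h"
      using frechet_derivative_compose[OF \<phi> that(1)] by simp
    also have "\<dots> = dd (\<lambda>y. dd \<phi> y (Y y)) x h"
      using frechet_derivative_cong_open[OF S(1,3), of "Y' \<circ> \<phi>"] that(3) by simp
    finally show ?thesis
      using frechet_derivative_frechet_derivative_apply[OF S that(2)] by simp
  qed
  have "dd Y' (\<phi> x) (dd \<phi> x (X x)) - dd X' (\<phi> x) (dd \<phi> x (Y x)) =
      dd \<phi> x (dd Y x (X x)) - dd \<phi> x (dd X x (Y x))"
    using *[OF diff(3,1) relX, of "Y x"] *[OF diff(4,2) relY, of "X x"]
      second_derivative_symmetric[OF S, of "X x" "Y x"] by simp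
  then show ?thesis
    by (simp add: vf_bracket_def relX[OF S(3)] relY[OF S(3)]
        linear_diff[OF linear_frechet_derivative[OF \<phi>]])
qed

text \<open>By the product rule each nested bracket splits into second derivatives, which cancel in
  pairs by symmetry, and compositions of first derivatives, which cancel across the cyclic
  sum.\<close>

lemma vf_bracket_jacobi:
  assumes S: "open S" "x \<in> S" "smooth_on S X" "smooth_on S Y" "smooth_on S Z"
  shows "vf_bracket X (vf_bracket Y Z) x + vf_bracket Y (vf_bracket Z X) x
    + vf_bracket Z (vf_bracket X Y) x = 0"
proof -
  have **: "dd (vf_bracket Y Z) x h = dd (\<lambda>y. dd Z y (Y x)) x h + dd Z x (dd Y x h)
      - (dd (\<lambda>y. dd Y y (Z x)) x h + dd Y x (dd Z x h))"
    if "smooth_on S Y" "smooth_on S Z" for Y Z h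
  proof -
    have "(vf_bracket Y Z has_derivative
      (\<lambda>h. (dd (\<lambda>y. dd Z y (Y x)) x h + dd Z x (dd Y x h))
      - (dd (\<lambda>y. dd Y y (Z x)) x h + dd Y x (dd Z x h)))) (at x)"
      unfolding vf_bracket_def[abs_def] using that S
      by (intro has_derivative_diff has_derivative_frechet_derivative_apply[of S])
        (auto intro: smooth_on_imp_differentiable)
    from frechet_derivative_at[OF this, THEN fun_cong, of h] show ?thesis
      by (rule sym)
  qed
  have lin: "linear (dd X x)" "linear (dd Y x)" "linear (dd Z x)"
    using S by (auto intro!: linear_frechet_derivative intro: smooth_on_imp_differentiable)
  have sym: "dd (\<lambda>y. dd f y u) x v = dd (\<lambda>y. dd f y v) x u" if "smooth_on S f" for f :: "'a \<Rightarrow> 'a" and u v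
    using second_derivative_symmetric S that by blast
  show ?thesis
    unfolding vf_bracket_def[of X "vf_bracket Y Z"] vf_bracket_def[of Y "vf_bracket Z X"]
      vf_bracket_def[of Z "vf_bracket X Y"] **[OF S(3,4)] **[OF S(4,5)] **[OF S(5,3)]
    by (simp add: vf_bracket_def linear_diff[OF lin(1)] linear_diff[OF lin(2)] linear_diff[OF lin(3)]
        sym[OF S(3), of "Z x" "Y x"] sym[OF S(4), of "Z x" "X x"] sym[OF S(5), of "Y x" "X x"])
qed


section \<open>Vector fields in charts\<close>

lemma is_chart_apply:
  assumes "is_chart c" "p \<in> fst c"
  shows "chart_inv c (snd c p) = p" "snd c p \<in> snd c ` fst c"
  using assms unfolding is_chart_def by (auto simp: homeomorphism_apply1)

lemma is_chart_inv_apply: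
  assumes "is_chart c" "x \<in> snd c ` fst c"
  shows "snd c (chart_inv c x) = x" "chart_inv c x \<in> fst c"
  using assms is_chart_apply by fastforce+

lemma open_chart_image:
  assumes "is_chart c" "open U"
  shows "open (snd c ` (fst c \<inter> U))"
proof -
  have "snd c ` (fst c \<inter> U) = snd c ` fst c \<inter> chart_inv c -` U"
    using is_chart_apply[OF assms(1)] by (auto simp: image_iff)
  moreover have "open \<dots>"
    using assms by (intro continuous_open_preimage)
      (auto simp: is_chart_def homeomorphism_def)
  ultimately show ?thesis by simp
qed

lemma smooth_atlas_is_chart: "smooth_atlas A \<Longrightarrow> c \<in> A \<Longrightarrow> is_chart c"
  by (simp add: smooth_atlas_def)

lemma smooth_atlas_chart_at:
  assumes "smooth_atlas A"
  shows "chart_at A p \<in> A" "p \<in> fst (chart_at A p)"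
proof -
  have "\<exists>c. c \<in> A \<and> p \<in> fst c"
    using assms unfolding smooth_atlas_def by blast
  then have "chart_at A p \<in> A \<and> p \<in> fst (chart_at A p)"
    unfolding chart_at_def by (rule someI_ex)
  then show "chart_at A p \<in> A" "p \<in> fst (chart_at A p)" by auto
qed

section \<open>Differentials of smooth maps in charts\<close>

lemma smooth_map_id: "smooth_atlas A \<Longrightarrow> smooth_map A A id"
  by (auto simp: smooth_atlas_def smooth_map_def)

text \<open>The differential of \<open>F\<close> at \<open>p\<close> in arbitrary charts, whereas
  \<open>tangent_map\<close> uses those picked by \<open>chart_at\<close>. For \<open>F = id\<close>
  it is the Jacobian of a change of coordinates.\<close>

definition local_deriv ::
  "('m, 'e::euclidean_space) chart \<Rightarrow> ('n, 'f::euclidean_space) chart \<Rightarrow> ('m \<Rightarrow> 'n) \<Rightarrow> 'm \<Rightarrow> 'e \<Rightarrow> 'f" where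
  "local_deriv c d F p = dd (snd d \<circ> F \<circ> chart_inv c) (snd c p)"

lemma tangent_map_eq_local_deriv:
  "tangent_map A B F p = local_deriv (chart_at A p) (chart_at B (F p)) F p"
  by (simp add: tangent_map_def local_deriv_def)

lemma smooth_map_local:
  assumes "smooth_atlas A" "smooth_atlas B" "smooth_map A B F" "c \<in> A" "d \<in> B"
  shows "open (snd c ` (fst c \<inter> F -` fst d))"
    and "smooth_on (snd c ` (fst c \<inter> F -` fst d)) (snd d \<circ> F \<circ> chart_inv c)"
proof -
  have "open (F -` fst d)"
    using assms by (intro open_vimage) (auto simp: smooth_map_def smooth_atlas_def is_chart_def)
  then show "open (snd c ` (fst c \<inter> F -` fst d))"
    using assms by (intro open_chart_image) (auto simp: smooth_atlas_def)
  show "smooth_on (snd c ` (fst c \<inter> F -` fst d)) (snd d \<circ> F \<circ> chart_inv c)"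
    using assms by (simp add: smooth_map_def)
qed

lemma smooth_map_local_differentiable:
  assumes "smooth_atlas A" "smooth_atlas B" "smooth_map A B F" "c \<in> A" "d \<in> B"
    and "p \<in> fst c" "F p \<in> fst d"
  shows "(snd d \<circ> F \<circ> chart_inv c) differentiable (at (snd c p))"
  using smooth_on_imp_differentiable[OF smooth_map_local(2)[OF assms(1-5)]] assms(6,7) by blast

lemma linear_local_deriv:
  assumes "smooth_atlas A" "smooth_atlas B" "smooth_map A B F" "c \<in> A" "d \<in> B"
    and "p \<in> fst c" "F p \<in> fst d"
  shows "linear (local_deriv c d F p)"
  unfolding local_deriv_def
  by (intro linear_frechet_derivative smooth_map_local_differentiable[OF assms])

lemma linear_tangent_map:
  assumes "smooth_atlas A" "smooth_atlas B" "smooth_map A B F"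
  shows "linear (tangent_map A B F p)"
  unfolding tangent_map_eq_local_deriv
  by (intro linear_local_deriv[OF assms] smooth_atlas_chart_at assms)

lemma local_deriv_id:
  assumes "smooth_atlas A" "c \<in> A" "p \<in> fst c"
  shows "local_deriv c c id p = id"
proof -
  have c: "is_chart c"
    using assms smooth_atlas_is_chart by blast
  then have "local_deriv c c id p = dd id (snd c p)"
    unfolding local_deriv_def
    using is_chart_inv_apply[OF c] is_chart_apply[OF c assms(3)]
    by (intro frechet_derivative_cong_open[of "snd c ` fst c"]) (auto simp: is_chart_def)
  then show ?thesis by simp
qed

lemma local_deriv_compose:
  assumes "smooth_atlas A" "smooth_atlas B" "smooth_atlas C"
    and F: "smooth_map A B F" and G: "smooth_map B C G"
    and charts: "c \<in> A" "d \<in> B" "e \<in> C" "p \<in> fst c" "F p \<in> fst d" "G (F p) \<in> fst e"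
  shows "local_deriv c e (G \<circ> F) p v = local_deriv d e G (F p) (local_deriv c d F p v)"
proof -
  have c: "is_chart c" and d: "is_chart d"
    using assms smooth_atlas_is_chart by blast+
  let ?F = "snd d \<circ> F \<circ> chart_inv c" and ?G = "snd e \<circ> G \<circ> chart_inv d"
  have "local_deriv c e (G \<circ> F) p = dd (?G \<circ> ?F) (snd c p)"
    unfolding local_deriv_def
    using charts is_chart_apply[OF c] is_chart_apply[OF d]
    by (intro frechet_derivative_cong_open[OF smooth_map_local(1)[OF assms(1,2) F charts(1,2)]]) auto
  moreover have "?F (snd c p) = snd d (F p)"
    using is_chart_apply[OF c] charts by simp
  moreover have "?F differentiable (at (snd c p))" "?G differentiable (at (snd d (F p)))"
    using assms by (auto intro!: smooth_map_local_differentiable)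
  ultimately show ?thesis
    by (simp add: local_deriv_def frechet_derivative_compose)
qed

lemma tangent_map_compose:
  assumes "smooth_atlas A" "smooth_atlas B" "smooth_atlas C"
    and "smooth_map A B F" "smooth_map B C G"
  shows "tangent_map A C (G \<circ> F) p v = tangent_map B C G (F p) (tangent_map A B F p v)"
  unfolding tangent_map_eq_local_deriv comp_apply[of G F p]
  by (intro local_deriv_compose[OF assms] smooth_atlas_chart_at assms)

lemma tangent_map_id: "smooth_atlas A \<Longrightarrow> tangent_map A A id p = id"
  unfolding tangent_map_eq_local_deriv id_apply[of p]
  by (intro local_deriv_id) (auto simp: smooth_atlas_chart_at)

text \<open>This lemma moves the target, and the next one the source, from the chart picked at the
  point to a prescribed chart. Both are the chain rule with an identity map; they bring relations
  stated with \<open>tangent_map\<close> into fixed charts.\<close>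

lemma local_deriv_tangent_map:
  assumes "smooth_atlas A" "smooth_atlas B" "smooth_map A B F" "d \<in> B" "F p \<in> fst d"
  shows "local_deriv (chart_at B (F p)) d id (F p) (tangent_map A B F p v) =
    local_deriv (chart_at A p) d F p v"
  using local_deriv_compose[OF assms(1,2,2,3) smooth_map_id[OF assms(2)], of "chart_at A p" "chart_at B (F p)" d p v]
    smooth_atlas_chart_at[OF assms(1)] smooth_atlas_chart_at[OF assms(2)] assms
  by (simp add: tangent_map_eq_local_deriv)

lemma local_deriv_change_chart:
  assumes "smooth_atlas A" "smooth_atlas B" "smooth_map A B F" "c \<in> A" "d \<in> B" "p \<in> fst c" "F p \<in> fst d"
  shows "local_deriv c d F p (local_deriv (chart_at A p) c id p v) = local_deriv (chart_at A p) d F p v"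
  using local_deriv_compose[OF assms(1,1,2) smooth_map_id[OF assms(1)] assms(3), of "chart_at A p" c d p v]
    smooth_atlas_chart_at[OF assms(1)] assms
  by simp

section \<open>Components of fields and naturality of the Lie bracket\<close>

lemma components_apply:
  assumes "is_chart c" "p \<in> fst c"
  shows "components A c X (snd c p) = local_deriv (chart_at A p) c id p (X p)"
  using is_chart_apply[OF assms] by (simp add: components_def local_deriv_def Let_def)

lemma components_chart_at:
  assumes "smooth_atlas A"
  shows "components A (chart_at A p) X (snd (chart_at A p) p) = X p"
  using components_apply[of "chart_at A p" p A X] smooth_atlas_chart_at[OF assms, of p]
    local_deriv_id[OF assms, of "chart_at A p" p] smooth_atlas_is_chart[OF assms] by simp

lemma lie_bracket_eq_vf_bracket:
  assumes "smooth_atlas A"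
  shows "lie_bracket A X Y p =
    vf_bracket (components A (chart_at A p) X) (components A (chart_at A p) Y) (snd (chart_at A p) p)"
  by (simp add: lie_bracket_def vf_bracket_def components_chart_at[OF assms] Let_def)

lemma components_differentiable:
  assumes "smooth_field A X" "c \<in> A" "p \<in> fst c"
  shows "components A c X differentiable (at (snd c p))"
  using assms by (auto simp: smooth_field_def intro: smooth_on_imp_differentiable)

text \<open>Relatedness is carried into fixed charts, where \<open>vf_bracket_related\<close>
  applies. The case \<open>F = id\<close> gives the bracket in any chart; left translations give
  left invariance of brackets.\<close>

lemma lie_bracket_related:
  assumes A: "smooth_atlas A" and B: "smooth_atlas B" and F: "smooth_map A B F"
    and X: "smooth_field A X" "smooth_field B X'" "\<And>q. X' (F q) = tangent_map A B F q (X q)"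
    and Y: "smooth_field A Y" "smooth_field B Y'" "\<And>q. Y' (F q) = tangent_map A B F q (Y q)"
    and d: "d \<in> B" "F p \<in> fst d"
  shows "vf_bracket (components B d X') (components B d Y') (snd d (F p)) =
    local_deriv (chart_at A p) d F p (lie_bracket A X Y p)"
proof -
  define c where "c = chart_at A p"
  have c: "c \<in> A" "p \<in> fst c"
    using smooth_atlas_chart_at[OF A] by (auto simp: c_def)
  have charts: "is_chart c" "is_chart d"
    using smooth_atlas_is_chart A B c d by blast+
  let ?S = "snd c ` (fst c \<inter> F -` fst d)" and ?\<phi> = "snd d \<circ> F \<circ> chart_inv c"
  \<comment> \<open>\<open>F\<close>-relatedness in the fixed charts \<open>c\<close> and
    \<open>d\<close>, although the tangent vectors at each \<open>q\<close> are stored in the chart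
    picked at \<open>q\<close>.\<close>
  have rel: "components B d Z' (?\<phi> y) = dd ?\<phi> y (components A c Z y)"
    if y: "y \<in> ?S" and rel: "\<And>q. Z' (F q) = tangent_map A B F q (Z q)" for Z Z' y
  proof -
    obtain q where q: "q \<in> fst c" "F q \<in> fst d" "y = snd c q"
      using y by blast
    have "components B d Z' (?\<phi> y) = local_deriv (chart_at A q) d F q (Z q)"
      using q components_apply[OF charts(2) q(2), of B Z'] is_chart_apply[OF charts(1) q(1)]
        local_deriv_tangent_map[OF A B F d(1) q(2)] rel by simp
    also have "\<dots> = local_deriv c d F q (components A c Z y)"
      using local_deriv_change_chart[OF A B F c(1) d(1) q(1,2)] components_apply[OF charts(1) q(1)] q(3)
      by metis
    finally show ?thesis
      by (simp add: local_deriv_def q(3))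
  qed
  have \<phi>: "?\<phi> (snd c p) = snd d (F p)"
    using is_chart_apply[OF charts(1) c(2)] by simp
  have "vf_bracket (components B d X') (components B d Y') (?\<phi> (snd c p)) =
      dd ?\<phi> (snd c p) (vf_bracket (components A c X) (components A c Y) (snd c p))"
    using c d X Y rel[of _ X' X] rel[of _ Y' Y]
    by (intro vf_bracket_related[OF smooth_map_local[OF A B F c(1) d(1)]])
      (auto intro!: components_differentiable simp: \<phi>[simplified])
  then show ?thesis
    by (simp add: lie_bracket_eq_vf_bracket[OF A] c_def[symmetric] local_deriv_def \<phi>[simplified])
qed

lemma components_lie_bracket:
  assumes A: "smooth_atlas A" and "smooth_field A X" "smooth_field A Y" "c \<in> A" "x \<in> snd c ` fst c"
  shows "components A c (lie_bracket A X Y) x = vf_bracket (components A c X) (components A c Y) x"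
proof -
  obtain p where p: "p \<in> fst c" "x = snd c p"
    using assms by blast
  show ?thesis
    using lie_bracket_related[OF A A smooth_map_id[OF A], of X X Y Y c p] assms p
      components_apply[of c p A "lie_bracket A X Y"] smooth_atlas_is_chart[OF A]
    by (simp add: tangent_map_id[OF A])
qed

text \<open>Near \<open>p\<close> the inner brackets are computed in the single chart picked at
  \<open>p\<close>, by \<open>components_lie_bracket\<close>, which reduces the claim to the
  Euclidean identity.\<close>

lemma lie_bracket_jacobi:
  assumes A: "smooth_atlas A" and X: "smooth_field A X" and Y: "smooth_field A Y" and Z: "smooth_field A Z"
  shows "lie_bracket A X (lie_bracket A Y Z) p + lie_bracket A Y (lie_bracket A Z X) p
    + lie_bracket A Z (lie_bracket A X Y) p = 0"
proof -
  define c where "c = chart_at A p"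
  have c: "c \<in> A" "p \<in> fst c" "is_chart c"
    using smooth_atlas_chart_at[OF A] smooth_atlas_is_chart[OF A] by (auto simp: c_def)
  have S: "open (snd c ` fst c)" "snd c p \<in> snd c ` fst c"
    using c by (auto simp: is_chart_def)
  have sm: "smooth_on (snd c ` fst c) (components A c X)" if "smooth_field A X" for X
    using that c by (simp add: smooth_field_def)
  have "lie_bracket A X (lie_bracket A Y Z) p =
      vf_bracket (components A c X) (vf_bracket (components A c Y) (components A c Z)) (snd c p)"
    if "smooth_field A X" "smooth_field A Y" "smooth_field A Z" for X Y Z
    unfolding lie_bracket_eq_vf_bracket[OF A, of X "lie_bracket A Y Z"] c_def[symmetric]
    using components_lie_bracket[OF A that(2,3) c(1)] S
    by (intro vf_bracket_cong_open[of "snd c ` fst c"]) auto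
  then show ?thesis
    using vf_bracket_jacobi[OF S sm[OF X] sm[OF Y] sm[OF Z]] X Y Z by simp
qed

section \<open>Smooth fields as a module over the smooth functions\<close>

lemma smooth_field_add:
  assumes A: "smooth_atlas A" and "smooth_field A X" "smooth_field A Y"
  shows "smooth_field A (\<lambda>p. X p + Y p)"
  unfolding smooth_field_def
proof
  fix c assume c: "c \<in> A"
  then have chart: "is_chart c" using smooth_atlas_is_chart[OF A] by blast
  have "components A c X x + components A c Y x = components A c (\<lambda>p. X p + Y p) x"
    if x: "x \<in> snd c ` fst c" for x
  proof -
    obtain p where p: "p \<in> fst c" "x = snd c p"
      using x by blast
    then have "linear (local_deriv (chart_at A p) c id p)"
      using c by (intro linear_local_deriv[OF A A smooth_map_id[OF A]]) (auto simp: smooth_atlas_chart_at[OF A])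
    then show ?thesis
      using p by (simp add: components_apply[OF chart] linear_add)
  qed
  note eq = this
  have "open (snd c ` fst c)"
    using chart by (simp add: is_chart_def)
  then show "smooth_on (snd c ` fst c) (components A c (\<lambda>p. X p + Y p))"
  proof (rule smooth_on_cong[OF _ eq])
    show "smooth_on (snd c ` fst c) (\<lambda>x. components A c X x + components A c Y x)"
      using assms c \<open>open (snd c ` fst c)\<close>
      by (intro smooth_on_add) (auto simp: smooth_field_def)
  qed
qed

lemma smooth_fun_local:
  assumes "smooth_fun A f" "c \<in> A"
  shows "smooth_on (snd c ` fst c) (f \<circ> chart_inv c)"
  using assms by (auto simp: smooth_map_def euclidean_atlas_def)

lemma smooth_fun_const: "smooth_fun A (\<lambda>p. r)"
  by (auto simp: smooth_map_def euclidean_atlas_def comp_def smooth_on_const)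

lemma smooth_field_scaleR:
  assumes A: "smooth_atlas A" and f: "smooth_fun A f" and X: "smooth_field A X"
  shows "smooth_field A (\<lambda>p. f p *\<^sub>R X p)"
  unfolding smooth_field_def
proof
  fix c assume c: "c \<in> A"
  then have chart: "is_chart c" using smooth_atlas_is_chart[OF A] by blast
  have "(f \<circ> chart_inv c) x *\<^sub>R components A c X x = components A c (\<lambda>p. f p *\<^sub>R X p) x"
    if x: "x \<in> snd c ` fst c" for x
  proof -
    obtain p where p: "p \<in> fst c" "x = snd c p"
      using x by blast
    then have "linear (local_deriv (chart_at A p) c id p)"
      using c by (intro linear_local_deriv[OF A A smooth_map_id[OF A]]) (auto simp: smooth_atlas_chart_at[OF A])
    then show ?thesis
      using p by (simp add: components_apply[OF chart] linear_cmul is_chart_apply[OF chart])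
  qed
  note eq = this
  have "open (snd c ` fst c)"
    using chart by (simp add: is_chart_def)
  then show "smooth_on (snd c ` fst c) (components A c (\<lambda>p. f p *\<^sub>R X p))"
  proof (rule smooth_on_cong[OF _ eq])
    show "smooth_on (snd c ` fst c) (\<lambda>x. (f \<circ> chart_inv c) x *\<^sub>R components A c X x)"
      using X c \<open>open (snd c ` fst c)\<close>
      by (intro smooth_on_scaleR smooth_fun_local[OF f]) (auto simp: smooth_field_def)
  qed
qed

lemma field_deriv_const: "field_deriv A X (\<lambda>p. r) p = 0"
  by (simp add: field_deriv_def tangent_map_def comp_def)




section \<open>Left invariant vector fields\<close>

lemma lie_group_smooth_atlas: "lie_group A \<Longrightarrow> smooth_atlas A"
  by (simp add: lie_group_def)

text \<open>Brings the group law, whose smoothness is stated with the product atlas, into a form in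
  which either coordinate variable can be frozen.\<close>

lemma lie_group_add_local:
  assumes A: "lie_group A" and charts: "e \<in> A" "c \<in> A" "d \<in> A"
  defines "W \<equiv> {(x, y). x \<in> snd e ` fst e \<and> y \<in> snd c ` fst c \<and> chart_inv e x + chart_inv c y \<in> fst d}"
  shows "open W" and "smooth_on W (\<lambda>(x, y). snd d (chart_inv e x + chart_inv c y))"
proof -
  have c: "is_chart c" and d: "is_chart d" and e: "is_chart e"
    using A charts lie_group_smooth_atlas smooth_atlas_is_chart by blast+
  define P where "P = (fst e \<times> fst c, map_prod (snd e) (snd c))"
  have "P \<in> prod_atlas A A"
    using charts by (force simp: P_def prod_atlas_def)
  moreover have add: "smooth_map (prod_atlas A A) A (\<lambda>(a, b). a + b)"
    using A by (simp add: lie_group_def)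
  ultimately have *: "smooth_on (snd P ` (fst P \<inter> (\<lambda>(a, b). a + b) -` fst d))
      (snd d \<circ> (\<lambda>(a, b). a + b) \<circ> chart_inv P)"
    using charts by (simp add: smooth_map_def)
  have W: "snd P ` (fst P \<inter> (\<lambda>(a, b). a + b) -` fst d) = W"
  proof (intro subset_antisym subsetI)
    fix z assume "z \<in> W"
    then obtain a b where "a \<in> fst e" "b \<in> fst c" "z = (snd e a, snd c b)" "a + b \<in> fst d"
      using is_chart_apply[OF c] is_chart_apply[OF e] by (auto simp: W_def)
    then show "z \<in> snd P ` (fst P \<inter> (\<lambda>(a, b). a + b) -` fst d)"
      by (force simp: P_def)
  qed (use is_chart_apply[OF c] is_chart_apply[OF e] in \<open>auto simp: W_def P_def\<close>)
  \<comment> \<open>\<open>chart_inv P\<close> is a chosen preimage under \<open>snd P\<close>, so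
    splitting it into components rests on injectivity of the product map.\<close>
  have inv: "chart_inv P (x, y) = (chart_inv e x, chart_inv c y)" if "(x, y) \<in> W" for x y
  proof -
    have "inj_on (snd e) (fst e)" "inj_on (snd c) (fst c)"
      using is_chart_apply(1)[OF c] is_chart_apply(1)[OF e] by (metis inj_on_inverseI)+
    then have "inj_on (map_prod (snd e) (snd c)) (fst e \<times> fst c)"
      by (rule map_prod_inj_on)
    then have "inv_into (fst P) (snd P) (x, y) = (chart_inv e x, chart_inv c y)"
      using that is_chart_inv_apply[OF c] is_chart_inv_apply[OF e]
      by (intro inv_into_f_eq) (auto simp: W_def P_def)
    then show ?thesis
      by (simp add: chart_inv_def[of P])
  qed
  have "continuous_on (snd e ` fst e \<times> snd c ` fst c) (\<lambda>z. (chart_inv e (fst z), chart_inv c (snd z)))"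
    using c e
    by (intro continuous_on_Pair continuous_on_compose2[of "snd e ` fst e" "chart_inv e" _ fst]
        continuous_on_compose2[of "snd c ` fst c" "chart_inv c" _ snd]
        continuous_on_fst continuous_on_snd continuous_on_id)
      (auto simp: is_chart_def homeomorphism_def)
  from continuous_on_compose2[OF _ this, of UNIV "\<lambda>(a, b). a + b"] add
  have "continuous_on (snd e ` fst e \<times> snd c ` fst c) (\<lambda>z. chart_inv e (fst z) + chart_inv c (snd z))"
    by (simp add: smooth_map_def case_prod_unfold)
  moreover have "W = (snd e ` fst e \<times> snd c ` fst c) \<inter> (\<lambda>z. chart_inv e (fst z) + chart_inv c (snd z)) -` fst d"
    by (auto simp: W_def)
  ultimately show "open W"
    using c d e by (auto simp: is_chart_def intro!: continuous_open_preimage open_Times)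
  then show "smooth_on W (\<lambda>(x, y). snd d (chart_inv e x + chart_inv c y))"
    by (rule smooth_on_cong[OF _ _ *[unfolded W]]) (auto simp: inv)
qed

lemma lie_group_continuous_add_left:
  fixes A :: "('g::{group_add, t2_space, second_countable_topology}, 'e::euclidean_space) chart set"
    and a :: 'g
  assumes "lie_group A"
  shows "continuous_on UNIV (\<lambda>q. a + q)"
proof -
  have "continuous_on UNIV (\<lambda>(a, b). a + b :: 'g)"
    using assms by (simp add: lie_group_def smooth_map_def)
  from continuous_on_compose2[OF this _ subset_UNIV, of UNIV "\<lambda>q. (a, q)"] show ?thesis
    by (simp add: continuous_on_Pair)
qed

lemma smooth_left_translation:
  assumes A: "lie_group A"
  shows "smooth_map A A (\<lambda>q. a + q)"
  unfolding smooth_map_def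
proof (intro conjI ballI)
  note atl = lie_group_smooth_atlas[OF A]
  show cont: "continuous_on UNIV (\<lambda>q. a + q)"
    by (rule lie_group_continuous_add_left[OF A])
  fix c d assume cd: "c \<in> A" "d \<in> A"
  have c: "is_chart c" and d: "is_chart d"
    using cd smooth_atlas_is_chart[OF atl] by blast+
  define e where "e = chart_at A a"
  have e: "e \<in> A" "a \<in> fst e" "is_chart e"
    using smooth_atlas_chart_at[OF atl] smooth_atlas_is_chart[OF atl] by (auto simp: e_def)
  let ?S = "snd c ` (fst c \<inter> (\<lambda>q. a + q) -` fst d)"
  define W where "W = {(x, y). x \<in> snd e ` fst e \<and> y \<in> snd c ` fst c \<and> chart_inv e x + chart_inv c y \<in> fst d}"
  have L: "linear (\<lambda>y. (0 :: 'b, y :: 'b))"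
    by (auto intro!: linearI)
  \<comment> \<open>Left translation by \<open>a\<close> is the group law with its first variable
    frozen at the coordinates of \<open>a\<close>, an affine precomposition.\<close>
  have "smooth_on ((\<lambda>y. (snd e a, 0) + (0, y)) -` W)
      (\<lambda>y. (\<lambda>(x, y). snd d (chart_inv e x + chart_inv c y)) ((snd e a, 0) + (0, y)))"
    unfolding W_def using lie_group_add_local[OF A e(1) cd] by (intro smooth_on_compose_affine L)
  moreover have "?S \<subseteq> (\<lambda>y. (snd e a, 0) + (0, y)) -` W"
    using is_chart_apply[OF c] is_chart_apply[OF e(3,2)] by (auto simp: W_def)
  ultimately have sm: "smooth_on ?S
      (\<lambda>y. (\<lambda>(x, y). snd d (chart_inv e x + chart_inv c y)) ((snd e a, 0) + (0, y)))"
    by (rule smooth_on_subset)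
  have "open ?S"
    using d cont by (intro open_chart_image c open_vimage) (auto simp: is_chart_def)
  then show "smooth_on ?S (snd d \<circ> (\<lambda>q. a + q) \<circ> chart_inv c)"
    by (rule smooth_on_cong[OF _ _ sm]) (simp add: is_chart_apply[OF e(3,2)])
qed

section \<open>Left invariant fields spread from the identity\<close>

definition left_field :: "('g::group_add, 'e::euclidean_space) chart set \<Rightarrow> 'e \<Rightarrow> 'g \<Rightarrow> 'e" where
  "left_field A v p = left_translation A p 0 v"

text \<open>In coordinates the field is the partial derivative of the group law in its second
  factor, taken at the identity in direction \<open>v\<close>; this depends smoothly on the first
  factor.\<close>

lemma smooth_left_field:
  assumes A: "lie_group A"
  shows "smooth_field A (left_field A v)"
  unfolding smooth_field_def
proof
  note atl = lie_group_smooth_atlas[OF A]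
  fix c assume c: "c \<in> A"
  then have chart: "is_chart c"
    using smooth_atlas_is_chart[OF atl] by blast
  define e where "e = chart_at A 0"
  have e: "e \<in> A" "0 \<in> fst e" "is_chart e"
    using smooth_atlas_chart_at[OF atl] smooth_atlas_is_chart[OF atl] by (auto simp: e_def)
  define y0 where "y0 = snd e 0"
  define W where "W = {(x, y). x \<in> snd c ` fst c \<and> y \<in> snd e ` fst e \<and> chart_inv c x + chart_inv e y \<in> fst c}"
  define M where "M = (\<lambda>(x, y). snd c (chart_inv c x + chart_inv e y))"
  have W: "open W" "smooth_on W M"
    unfolding W_def M_def by (rule lie_group_add_local[OF A c e(1) c])+
  \<comment> \<open>Adding the identity does not move a point, so the slice through
    \<open>y0\<close> lies in \<open>W\<close> over the whole chart \<open>c\<close>.\<close>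
  have mem: "(x, y0) \<in> W" if "x \<in> snd c ` fst c" for x
    using that is_chart_apply[OF e(3,2)] is_chart_inv_apply[OF chart] by (auto simp: W_def y0_def)
  have L: "linear (\<lambda>x. (x :: 'b, 0 :: 'b))"
    by (auto intro!: linearI)
  have "smooth_on ((\<lambda>x. (0, y0) + (x, 0)) -` W) (\<lambda>x. dd M ((0, y0) + (x, 0)) (0, v))"
    using W by (intro smooth_on_compose_affine[of W _ "\<lambda>x. dd M x (0, v)"] L smooth_on_frechet_derivative)
  then have sm: "smooth_on (snd c ` fst c) (\<lambda>x. dd M ((0, y0) + (x, 0)) (0, v))"
    using mem by (rule_tac smooth_on_subset) auto
  show "smooth_on (snd c ` fst c) (components A c (left_field A v))"
  proof (rule smooth_on_cong[OF _ _ sm])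
    show "open (snd c ` fst c)"
      using chart by (simp add: is_chart_def)
    fix x assume "x \<in> snd c ` fst c"
    then obtain p where p: "p \<in> fst c" "x = snd c p" by blast
    have inv: "chart_inv c x = p"
      using is_chart_apply[OF chart] p by simp
    have "components A c (left_field A v) x = local_deriv e c (\<lambda>q. p + q) 0 v"
      using components_apply[OF chart p(1), of A "left_field A v"]
        local_deriv_tangent_map[OF atl atl smooth_left_translation[OF A, of p] c, of 0 v] p
      by (simp add: left_field_def e_def)
    also have "\<dots> = dd (M \<circ> (\<lambda>y. (x, y))) y0 v"
      by (simp add: local_deriv_def M_def y0_def comp_def inv)
    also have "\<dots> = dd M (x, y0) (dd (\<lambda>y. (x, y)) y0 v)"
      using mem[of x] smooth_on_imp_differentiable[OF W(2)] \<open>x \<in> snd c ` fst c\<close>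
      by (subst frechet_derivative_compose) auto
    also have "dd (\<lambda>y. (x, y)) y0 = (\<lambda>v. (0, v))"
      by (rule frechet_derivative_at[symmetric]) (auto intro!: derivative_eq_intros)
    finally show "dd M ((0, y0) + (x, 0)) (0, v) = components A c (left_field A v) x"
      by simp
  qed
qed

lemma left_translation_compose:
  assumes A: "lie_group A"
  shows "left_translation A a (b + p) (left_translation A b p v) = left_translation A (a + b) p v"
  using tangent_map_compose[of A A A "\<lambda>q. b + q" "\<lambda>q. a + q" p v] smooth_left_translation[OF A]
    lie_group_smooth_atlas[OF A] by (simp add: comp_def add.assoc)

lemma left_translation_0:
  assumes A: "lie_group A"
  shows "left_translation A 0 p v = v"
  using tangent_map_id[OF lie_group_smooth_atlas[OF A], of p] by (simp add: id_def)

lemma linear_left_translation: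
  assumes A: "lie_group A"
  shows "linear (left_translation A a p)"
  using linear_tangent_map smooth_left_translation[OF A] lie_group_smooth_atlas[OF A] by blast

lemma left_field_in_lie_algebra:
  assumes A: "lie_group A"
  shows "left_field A v \<in> lie_algebra A"
  using smooth_left_field[OF A] left_translation_compose[OF A, of _ _ 0]
  by (simp add: lie_algebra_def left_field_def)

lemma left_field_0:
  assumes A: "lie_group A"
  shows "left_field A v 0 = v"
  using left_translation_0[OF A] by (simp add: left_field_def)

lemma lie_algebra_eq_left_field:
  assumes "X \<in> lie_algebra A"
  shows "X = left_field A (X 0)"
proof
  fix p
  have "left_translation A p 0 (X 0) = X (p + 0)"
    using assms unfolding lie_algebra_def by blast
  then show "X p = left_field A (X 0) p"
    by (simp add: left_field_def)
qed

text \<open>The vector sought is \<open>w\<close> translated back to the identity by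
  \<open>- p\<close>.\<close>

lemma left_field_surj:
  assumes A: "lie_group A"
  obtains v where "left_field A v p = w"
  using left_translation_compose[OF A, of p "- p" p w] left_translation_0[OF A]
  by (auto simp: left_field_def)

text \<open>Every left translation relates a left invariant field to itself, so naturality applies.
  Smoothness of the bracket is a hypothesis here and is supplied later by a torsion-free
  connection.\<close>

lemma lie_bracket_in_lie_algebra:
  assumes A: "lie_group A" and X: "X \<in> lie_algebra A" and Y: "Y \<in> lie_algebra A"
    and smooth: "smooth_field A (lie_bracket A X Y)"
  shows "lie_bracket A X Y \<in> lie_algebra A"
proof -
  note atl = lie_group_smooth_atlas[OF A]
  have "left_translation A a p (lie_bracket A X Y p) = lie_bracket A X Y (a + p)" for a p
    using lie_bracket_related[OF atl atl smooth_left_translation[OF A, of a], of X X Y Y "chart_at A (a + p)" p]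
      X Y smooth_atlas_chart_at[OF atl]
    by (simp add: lie_algebra_def lie_bracket_eq_vf_bracket[OF atl, of X Y "a + p"] tangent_map_eq_local_deriv)
  then show ?thesis
    using smooth by (simp add: lie_algebra_def)
qed


section \<open>The algebra of an abelian anti-Kaehler product\<close>

text \<open>\<open>B (T u v) w\<close> is symmetric in its first two arguments and skew in its last
  two. Alternating these exchanges, three times each, returns to the start with the sign
  reversed.\<close>

lemma bilinear_symmetric_skew_eq_zero:
  fixes B :: "'v::real_vector \<Rightarrow> 'v \<Rightarrow> real"
  assumes B: "bilinear B" "\<And>u v. B u v = B v u" "\<And>u. (\<And>w. B u w = 0) \<Longrightarrow> u = 0"
    and sym: "\<And>u v. T u v = T v u" and skew: "\<And>u v w. B (T u v) w = - B v (T u w)"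
  shows "T u v = 0"
proof (rule B(3))
  fix w
  have t: "B (T u v) w = B (T v u) w" "B (T u v) w = - B (T u w) v" for u v w
    using sym skew[of u v w] B(2) by auto
  show "B (T u v) w = 0"
    using t(2)[of u v w] t(1)[of u w v] t(2)[of w u v] t(1)[of w v u] t(2)[of v w u] t(1)[of v u w]
    by linarith
qed

text \<open>Add the first Bianchi identity over the four cyclic shifts of the arguments, two of them
  with a minus sign; all other terms cancel by skewness.\<close>

lemma curvature_pair_symmetry:
  fixes r :: "'v \<Rightarrow> 'v \<Rightarrow> 'v \<Rightarrow> 'v \<Rightarrow> real"
  assumes "\<And>u v w z. r u v w z = - r v u w z" "\<And>u v w z. r u v w z = - r u v z w"
    and "\<And>u v w z. r u v w z + r v w u z + r w u v z = 0"
  shows "r u v w z = r w z u v"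
  using assms(3)[of u v w z] assms(3)[of v w z u] assms(3)[of w z u v] assms(3)[of z u v w]
    assms(2)[of v w u z] assms(1)[of w u v z] assms(2)[of z v w u] assms(1)[of z v u w]
    assms(2)[of u v z w] assms(2)[of w z v u] assms(2)[of z u w v] assms(1)[of u w z v]
    assms(1)[of v z u w] assms(2)[of w u v z] assms(1)[of w u z v] assms(2)[of z v u w]
  by linarith

text \<open>Here \<open>m\<close> stands for the covariant derivative of left invariant fields, so
  \<open>m u v - m v u\<close> is their Lie bracket and the conclusion is the vanishing of the
  curvature.\<close>

lemma abelian_anti_kaehler_product_flat:
  fixes m :: "'v::real_vector \<Rightarrow> 'v \<Rightarrow> 'v" and j :: "'v \<Rightarrow> 'v" and B :: "'v \<Rightarrow> 'v \<Rightarrow> real"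
  assumes m: "bilinear m" and j: "linear j" "\<And>u. j (j u) = - u"
    and B: "bilinear B" "\<And>u v. B u v = B v u" "\<And>u. (\<And>w. B u w = 0) \<Longrightarrow> u = 0"
    and compatible: "\<And>u v w. B (m u v) w + B v (m u w) = 0"
    and anti: "\<And>u v. B (j u) (j v) = - B u v"
    and parallel: "\<And>u v. m u (j v) = j (m u v)"
    and abelian: "\<And>u v. m (j u) (j v) - m (j v) (j u) = m u v - m v u"
    and jacobi: "\<And>u v w. m u (m v w - m w v) - m (m v w - m w v) u
      + (m v (m w u - m u w) - m (m w u - m u w) v)
      + (m w (m u v - m v u) - m (m u v - m v u) w) = 0"
  shows "m u (m v w) - m v (m u w) - m (m u v - m v u) w = 0"
proof -
  note m_simps = bilinear_ladd[OF m] bilinear_radd[OF m] bilinear_lsub[OF m] bilinear_rsub[OF m]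
    bilinear_lneg[OF m] bilinear_rneg[OF m]
  note j_simps = linear_add[OF j(1)] linear_diff[OF j(1)] linear_neg[OF j(1)] j(2)
  note B_simps = bilinear_ladd[OF B(1)] bilinear_radd[OF B(1)] bilinear_lsub[OF B(1)]
    bilinear_rsub[OF B(1)] bilinear_lneg[OF B(1)] bilinear_rneg[OF B(1)]
  have j_sym: "B (j u) v = B u (j v)" for u v
    using anti[of u "j v"] by (simp add: j_simps B_simps)
  have skew: "B (m u v) w = - B v (m u w)" for u v w
    using compatible[of u v w] by linarith
  have "m (j u) v + j (m u v) = 0" for u v
  proof (rule bilinear_symmetric_skew_eq_zero[OF B, where T = "\<lambda>u v. m (j u) v + j (m u v)"])
    \<comment> \<open>\<open>abelian\<close> at \<open>u\<close> and \<open>j v\<close> turns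
      \<open>j (j v)\<close> into \<open>- v\<close>; pulling \<open>j\<close> out of the second
      factor by \<open>parallel\<close> leaves this symmetry.\<close>
    show "m (j u) v + j (m u v) = m (j v) u + j (m v u)" for u v
      using abelian[of u "j v"] by (simp add: j_simps m_simps parallel algebra_simps)
    show "B (m (j u) v + j (m u v)) w = - B v (m (j u) w + j (m u w))" for u v w
      by (simp add: B_simps skew j_sym parallel)
  qed
  then have m_j: "m (j u) v = - j (m u v)" for u v
    by (simp add: eq_neg_iff_add_eq_0)
  define R where "R u v w = m u (m v w) - m v (m u w) - m (m u v - m v u) w" for u v w
  have R_anti: "R u v w = - R v u w" for u v w
    by (simp add: R_def m_simps)
  have R_skew: "B (R u v w) z = - B (R u v z) w" for u v w z
    by (simp add: R_def B_simps skew m_simps B(2)[of _ w])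
  \<comment> \<open>Regrouping the Jacobi identity of the commutator of \<open>m\<close> gives the
    first Bianchi identity.\<close>
  have bianchi: "R u v w + R v w u + R w u v = 0" for u v w
    using jacobi[of u v w] by (simp add: R_def m_simps algebra_simps)
  have pair: "B (R u v w) z = B (R w z u) v" for u v w z
  proof (rule curvature_pair_symmetry[of "\<lambda>u v w z. B (R u v w) z"])
    show "B (R u v w) z = - B (R v u w) z" for u v w z
      using R_anti[of u v w] by (simp add: B_simps)
    show "B (R u v w) z + B (R v w u) z + B (R w u v) z = 0" for u v w z
      using bianchi[of u v w] bilinear_lzero[OF B(1)] by (simp add: B_simps[symmetric])
  qed (rule R_skew)
  have R_j: "R u v (j w) = j (R u v w)" for u v w
    by (simp add: R_def parallel j_simps)
  \<comment> \<open>Pair symmetry moves \<open>j\<close> from the first pair of arguments into the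
    second, where it commutes with \<open>R\<close> and is self-adjoint for
    \<open>B\<close>.\<close>
  have R_j_left: "R (j u) v w = R u (j v) w" for u v w
  proof -
    have "B (R (j u) v w - R u (j v) w) z = 0" for z
      using pair[of "j u" v w z] pair[of u "j v" w z] by (simp add: B_simps R_j j_sym)
    then show ?thesis
      using B(3) by (metis eq_iff_diff_eq_0)
  qed
  have R_minus: "R u (- v) w = - R u v w" for u v w
    by (simp add: R_def m_simps j_simps)
  \<comment> \<open>Two evaluations of \<open>R (j u) (j v)\<close>: by \<open>R_j_left\<close> it
    is \<open>- R u v\<close>; by \<open>m_j\<close> the commutator of the operators changes sign
    while the bracket term stays, being abelian. The difference is twice the bracket term.\<close>
  have br: "m (m u v - m v u) w = 0" for u v w
  proof -
    have "R (j u) (j v) w = - R u v w"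
      using R_j_left[of u "j v" w] by (simp add: j(2) R_minus)
    moreover have "R (j u) (j v) w = - (m u (m v w)) + m v (m u w) - m (m u v - m v u) w"
      unfolding R_def abelian by (simp add: m_j m_simps j_simps parallel)
    ultimately have "2 *\<^sub>R m (m u v - m v u) w = 0"
      by (simp add: R_def[of u v w] scaleR_2 algebra_simps)
    then show ?thesis by simp
  qed
  have R_eq: "R u v w = m u (m v w) - m v (m u w)" for u v w
    by (simp add: R_def br)
  \<comment> \<open>Without the bracket term, \<open>R\<close> inherits from \<open>m_j\<close> the
    antilinearity in its first argument.\<close>
  have R_j_left': "R (j u) v w = - j (R u v w)" for u v w
    by (simp add: R_eq m_j m_simps j_simps parallel)
  \<comment> \<open>In the Bianchi identity at \<open>j u\<close>, \<open>v\<close>,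
    \<open>w\<close> only the middle term keeps its sign relative to \<open>j\<close> applied to the
    identity at \<open>u\<close>, \<open>v\<close>, \<open>w\<close>. Adding the two isolates
    \<open>2 *\<^sub>R j (R v w u)\<close>.\<close>
  have "R v w u = 0" for u v w
  proof -
    have "R w (j u) v = - j (R w u v)"
      using R_anti[of w "j u" v] R_anti[of w u v] by (simp add: R_j_left' j_simps)
    moreover have "j (R u v w) + j (R v w u) + j (R w u v) = 0"
      using bianchi[of u v w] linear_0[OF j(1)] by (simp add: j_simps[symmetric])
    ultimately have "2 *\<^sub>R j (R v w u) = 0"
      using bianchi[of "j u" v w] by (simp add: R_j_left' R_j scaleR_2 algebra_simps)
    then have "j (j (R v w u)) = 0"
      using linear_0[OF j(1)] by simp
    then show ?thesis
      by (simp add: j(2))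
  qed
  then show ?thesis
    by (simp add: R_def)
qed


section \<open>Levi-Civita connections of left invariant metrics\<close>

text \<open>The Koszul formula. Its right-hand side does not involve \<open>D\<close>, which gives
  uniqueness on smooth fields; on left invariant fields its derivative terms vanish.\<close>

lemma levi_civita_koszul:
  assumes metric: "pseudo_riemannian_metric A g" and D: "levi_civita A g D"
    and smooth: "smooth_field A X" "smooth_field A Y" "smooth_field A Z"
  shows "2 * g p (D X Y p) (Z p) =
    field_deriv A X (\<lambda>q. g q (Y q) (Z q)) p + field_deriv A Y (\<lambda>q. g q (Z q) (X q)) p
    - field_deriv A Z (\<lambda>q. g q (X q) (Y q)) p
    + g p (lie_bracket A X Y p) (Z p) - g p (lie_bracket A X Z p) (Y p) - g p (lie_bracket A Y Z p) (X p)"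
proof -
  have bil: "bilinear (g p)" and sym: "g p v w = g p w v" for p v w
    using metric by (auto simp: pseudo_riemannian_metric_def)
  have compat: "field_deriv A X (\<lambda>q. g q (Y q) (Z q)) p = g p (D X Y p) (Z p) + g p (Y p) (D X Z p)"
    if "smooth_field A X" "smooth_field A Y" "smooth_field A Z" for X Y Z
    using D that by (simp add: levi_civita_def metric_compatible_def)
  have torsion: "lie_bracket A X Y p = D X Y p - D Y X p" if "smooth_field A X" "smooth_field A Y" for X Y
    using D that by (simp add: levi_civita_def torsion_free_def)
  show ?thesis
    using smooth sym[of p "Y p"] sym[of p "Z p"] sym[of p "X p"]
    by (simp add: compat torsion bilinear_lsub[OF bil])
qed

locale left_invariant_levi_civita =
  fixes A :: "('g::{group_add, t2_space, second_countable_topology}, 'e::euclidean_space) chart set"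
    and g :: "'g \<Rightarrow> 'e \<Rightarrow> 'e \<Rightarrow> real"
    and D :: "('g \<Rightarrow> 'e) \<Rightarrow> ('g \<Rightarrow> 'e) \<Rightarrow> ('g \<Rightarrow> 'e)"
  assumes lie: "lie_group A"
    and metric: "pseudo_riemannian_metric A g"
    and left_invariant: "left_invariant_metric A g"
    and levi_civita: "levi_civita A g D"
begin

abbreviation E :: "'e \<Rightarrow> 'g \<Rightarrow> 'e" where
  "E \<equiv> left_field A"

lemma atlas: "smooth_atlas A"
  using lie by (rule lie_group_smooth_atlas)

lemma bilinear_metric: "bilinear (g p)"
  using metric by (simp add: pseudo_riemannian_metric_def)

lemma metric_commute: "g p v w = g p w v"
  using metric by (simp add: pseudo_riemannian_metric_def)

lemma metric_nondegenerate: "(\<And>w. g p v w = 0) \<Longrightarrow> v = 0"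
  using metric unfolding pseudo_riemannian_metric_def by blast

lemma smooth_fun_metric:
  "smooth_field A X \<Longrightarrow> smooth_field A Y \<Longrightarrow> smooth_fun A (\<lambda>p. g p (X p) (Y p))"
  using metric by (simp add: pseudo_riemannian_metric_def)

section \<open>The left invariant frame and its dual\<close>

lemma smooth_E: "smooth_field A (E v)"
  using lie by (rule smooth_left_field)

lemma E_add: "E (u + v) = (\<lambda>p. E u p + E v p)"
  by (auto simp: left_field_def linear_add[OF linear_left_translation[OF lie]])

lemma E_scaleR: "E (r *\<^sub>R v) = (\<lambda>p. r *\<^sub>R E v p)"
  by (auto simp: left_field_def linear_cmul[OF linear_left_translation[OF lie]])

lemma linear_E: "linear (\<lambda>v. E v p)"
  by (intro linearI) (simp_all add: E_add E_scaleR)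

lemma lie_algebra_eq_E: "X \<in> lie_algebra A \<Longrightarrow> X = E (X 0)"
  by (rule lie_algebra_eq_left_field)

lemma metric_E: "g p (E u p) (E v p) = g 0 u v"
proof -
  have "g (p + 0) (left_translation A p 0 u) (left_translation A p 0 v) = g 0 u v"
    using left_invariant unfolding left_invariant_metric_def by blast
  then show ?thesis
    by (simp add: left_field_def)
qed

text \<open>The map \<open>T\<close> below represents \<open>g 0\<close> through the inner product.
  Nondegeneracy makes it injective, hence surjective in finite dimension, and \<open>w\<close> is a
  preimage of \<open>b\<close>.\<close>

lemma dual_vector:
  obtains w where "\<And>v. g 0 v w = v \<bullet> b"
proof -
  define T where "T w = (\<Sum>c\<in>Basis. g 0 c w *\<^sub>R c)" for w
  have T: "T w \<bullet> v = g 0 v w" for v w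
  proof -
    have "g 0 v w = (\<Sum>c\<in>Basis. (v \<bullet> c) * g 0 c w)"
      by (subst euclidean_representation[of v, symmetric])
        (simp add: linear_sum[OF bilinear_metric[unfolded bilinear_def, THEN conjunct2, rule_format]]
          bilinear_lmul[OF bilinear_metric])
    then show ?thesis
      by (simp add: T_def inner_sum_left mult.commute inner_commute[of v])
  qed
  have "linear T"
    unfolding T_def
    by (intro linearI) (simp_all add: bilinear_radd[OF bilinear_metric] bilinear_rmul[OF bilinear_metric]
        scaleR_add_left sum.distrib scaleR_sum_right)
  moreover have "inj T"
  proof (subst linear_injective_0[OF \<open>linear T\<close>], intro allI impI)
    fix w assume "T w = 0"
    then have "g 0 w v = 0" for v
      using T[of w v] metric_commute by simp
    then show "w = 0"
      using metric_nondegenerate by blast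
  qed
  ultimately have "surj T"
    by (rule linear_injective_imp_surjective) simp
  then obtain w where "T w = b"
    by (metis surjD)
  then show thesis
    using that T by (metis inner_commute)
qed

text \<open>Every smooth field is a finite sum of smooth multiples of frame fields
  \<open>E b\<close>, so properties stable under sums need checking on such multiples only.\<close>

lemma frame_induct:
  assumes X: "smooth_field A X"
    and add: "\<And>X Y. smooth_field A X \<Longrightarrow> smooth_field A Y \<Longrightarrow> P X \<Longrightarrow> P Y \<Longrightarrow> P (\<lambda>p. X p + Y p)"
    and scale: "\<And>f v. smooth_fun A f \<Longrightarrow> P (\<lambda>p. f p *\<^sub>R E v p)"
  shows "P X"
proof -
  have "\<exists>w. \<forall>v. g 0 v w = v \<bullet> b" for b
    using dual_vector by metis
  then obtain w where w: "\<And>b v. g 0 v (w b) = v \<bullet> b"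
    by metis
  \<comment> \<open>The coefficient of \<open>X\<close> at \<open>E b\<close>: the metric pairing
    with the dual frame field, which is smooth because \<open>X\<close>, the frame and the metric
    are.\<close>
  define f where "f b = (\<lambda>p. g p (X p) (E (w b) p))" for b
  have f: "smooth_fun A (f b)" for b
    unfolding f_def by (intro smooth_fun_metric X smooth_E)
  have "smooth_field A (\<lambda>p. \<Sum>b\<in>B. f b p *\<^sub>R E b p) \<and> P (\<lambda>p. \<Sum>b\<in>B. f b p *\<^sub>R E b p)"
    if "finite B" for B
    using that
  proof (induction B)
    case empty
    \<comment> \<open>The empty sum is the zero field, covered by \<open>scale\<close> with the
      coefficient function 0.\<close>
    show ?case
      using scale[OF smooth_fun_const[of _ 0]]
        smooth_field_scaleR[OF atlas smooth_fun_const[of _ 0] smooth_E] by simp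
  next
    case (insert b B)
    then show ?case
      using add[of "\<lambda>p. f b p *\<^sub>R E b p" "\<lambda>p. \<Sum>b\<in>B. f b p *\<^sub>R E b p"] scale[OF f]
        smooth_field_scaleR[OF atlas f smooth_E]
        smooth_field_add[OF atlas, of "\<lambda>p. f b p *\<^sub>R E b p" "\<lambda>p. \<Sum>b\<in>B. f b p *\<^sub>R E b p"]
      by simp
  qed
  moreover have "X p = (\<Sum>b\<in>Basis. f b p *\<^sub>R E b p)" for p
  proof -
    obtain v where v: "E v p = X p"
      using left_field_surj[OF lie] by blast
    have "X p = E (\<Sum>b\<in>Basis. (v \<bullet> b) *\<^sub>R b) p"
      by (simp add: euclidean_representation v)
    also have "\<dots> = (\<Sum>b\<in>Basis. (v \<bullet> b) *\<^sub>R E b p)"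
      by (simp add: linear_sum[OF linear_E] linear_cmul[OF linear_E])
    also have "\<dots> = (\<Sum>b\<in>Basis. f b p *\<^sub>R E b p)"
      using metric_E[of p v] by (simp add: f_def v w)
    finally show ?thesis .
  qed
  ultimately show ?thesis
    using finite_Basis by (metis (no_types, lifting) ext)
qed

section \<open>Rules for the connection and the bracket on smooth fields\<close>

lemma smooth_D: "smooth_field A X \<Longrightarrow> smooth_field A Y \<Longrightarrow> smooth_field A (D X Y)"
  using levi_civita by (simp add: levi_civita_def affine_connection_def)

lemma D_add_left:
  "smooth_field A X \<Longrightarrow> smooth_field A Y \<Longrightarrow> smooth_field A Z \<Longrightarrow>
    D (\<lambda>p. X p + Y p) Z = (\<lambda>p. D X Z p + D Y Z p)"
  using levi_civita by (simp add: levi_civita_def affine_connection_def)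

lemma D_add_right:
  "smooth_field A X \<Longrightarrow> smooth_field A Y \<Longrightarrow> smooth_field A Z \<Longrightarrow>
    D X (\<lambda>p. Y p + Z p) = (\<lambda>p. D X Y p + D X Z p)"
  using levi_civita by (simp add: levi_civita_def affine_connection_def)

lemma D_scaleR_left:
  "smooth_fun A f \<Longrightarrow> smooth_field A X \<Longrightarrow> smooth_field A Y \<Longrightarrow>
    D (\<lambda>p. f p *\<^sub>R X p) Y = (\<lambda>p. f p *\<^sub>R D X Y p)"
  using levi_civita by (simp add: levi_civita_def affine_connection_def)

lemma D_scaleR_right:
  "smooth_fun A f \<Longrightarrow> smooth_field A X \<Longrightarrow> smooth_field A Y \<Longrightarrow>
    D X (\<lambda>p. f p *\<^sub>R Y p) = (\<lambda>p. field_deriv A X f p *\<^sub>R Y p + f p *\<^sub>R D X Y p)"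
  using levi_civita by (simp add: levi_civita_def affine_connection_def)

text \<open>Through this expression the bracket inherits smoothness, additivity and its product rule
  from \<open>D\<close>.\<close>

lemma lie_bracket_eq:
  "smooth_field A X \<Longrightarrow> smooth_field A Y \<Longrightarrow> lie_bracket A X Y = (\<lambda>p. D X Y p - D Y X p)"
  using levi_civita by (simp add: levi_civita_def torsion_free_def fun_eq_iff)

lemma smooth_field_scaleR_const: "smooth_field A X \<Longrightarrow> smooth_field A (\<lambda>p. r *\<^sub>R X p)"
  using smooth_field_scaleR[OF atlas smooth_fun_const] .

lemma smooth_field_diff:
  "smooth_field A X \<Longrightarrow> smooth_field A Y \<Longrightarrow> smooth_field A (\<lambda>p. X p - Y p)"
  using smooth_field_add[OF atlas, of X "\<lambda>p. (-1) *\<^sub>R Y p"] smooth_field_scaleR_const[of Y "-1"]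
  by simp

lemma smooth_lie_bracket:
  "smooth_field A X \<Longrightarrow> smooth_field A Y \<Longrightarrow> smooth_field A (lie_bracket A X Y)"
  by (simp add: lie_bracket_eq smooth_field_diff smooth_D)

lemma lie_bracket_scaleR_right:
  assumes "smooth_fun A f" "smooth_field A X" "smooth_field A Y"
  shows "lie_bracket A X (\<lambda>p. f p *\<^sub>R Y p) =
    (\<lambda>p. field_deriv A X f p *\<^sub>R Y p + f p *\<^sub>R lie_bracket A X Y p)"
  using assms
  by (auto simp: lie_bracket_eq smooth_field_scaleR[OF atlas] D_scaleR_left D_scaleR_right algebra_simps)

lemma lie_bracket_add_right:
  assumes "smooth_field A X" "smooth_field A Y" "smooth_field A Z"
  shows "lie_bracket A X (\<lambda>p. Y p + Z p) = (\<lambda>p. lie_bracket A X Y p + lie_bracket A X Z p)"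
  using assms
  by (auto simp: lie_bracket_eq smooth_field_add[OF atlas] D_add_left D_add_right algebra_simps)

lemma lie_bracket_anti:
  "smooth_field A X \<Longrightarrow> smooth_field A Y \<Longrightarrow> lie_bracket A Y X = (\<lambda>p. (-1) *\<^sub>R lie_bracket A X Y p)"
  by (auto simp: lie_bracket_eq)

lemma lie_bracket_leibniz:
  assumes "smooth_field A X" "smooth_field A Y" "smooth_field A Z"
  shows "lie_bracket A X (lie_bracket A Y Z) p =
    lie_bracket A Y (lie_bracket A X Z) p + lie_bracket A (lie_bracket A X Y) Z p"
proof -
  have "lie_bracket A Y (lie_bracket A Z X) p = - lie_bracket A Y (lie_bracket A X Z) p"
    unfolding lie_bracket_anti[OF assms(1,3)]
    using lie_bracket_scaleR_right[OF smooth_fun_const assms(2) smooth_lie_bracket[OF assms(1,3)], of "-1"]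
    by (simp add: field_deriv_const)
  moreover have "lie_bracket A Z (lie_bracket A X Y) p = - lie_bracket A (lie_bracket A X Y) Z p"
    using lie_bracket_anti[OF smooth_lie_bracket[OF assms(1,2)] assms(3)] by simp
  ultimately show ?thesis
    using lie_bracket_jacobi[OF atlas assms, of p] by (simp add: algebra_simps)
qed

text \<open>Pairing with \<open>E v\<close> recovers a function from its multiple of
  \<open>E u\<close>, and shows that \<open>E u\<close> vanishes nowhere.\<close>

lemma dual_frame_vectors:
  obtains u v where "\<And>p. g p (E u p) (E v p) = 1"
proof -
  obtain b :: 'e where b: "b \<in> Basis"
    using nonempty_Basis by blast
  obtain w where "\<And>v. g 0 v w = v \<bullet> b"
    using dual_vector by blast
  then have "g p (E b p) (E w p) = 1" for p
    using b by (simp add: metric_E)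
  then show thesis
    using that by blast
qed

text \<open>
  With \<open>g (E u) (E v) = 1\<close>, the function \<open>X f\<close> is the inner product of \<open>E v\<close> with
  \<open>(X f) E u = D X (f E u) - f D X (E u)\<close>, which is smooth since \<open>D\<close> preserves smooth fields.
\<close>

lemma smooth_field_deriv:
  assumes "smooth_field A X" "smooth_fun A f"
  shows "smooth_fun A (field_deriv A X f)"
proof -
  obtain u v where uv: "\<And>p. g p (E u p) (E v p) = 1"
    using dual_frame_vectors by blast
  have "smooth_field A (\<lambda>p. D X (\<lambda>p. f p *\<^sub>R E u p) p - f p *\<^sub>R D X (E u) p)"
    by (intro smooth_field_diff smooth_D smooth_field_scaleR[OF atlas] assms smooth_E)
  then have "smooth_field A (\<lambda>p. field_deriv A X f p *\<^sub>R E u p)"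
    by (simp add: D_scaleR_right assms smooth_E)
  from smooth_fun_metric[OF this smooth_E[of v]] show ?thesis
    by (simp add: bilinear_lmul[OF bilinear_metric] uv)
qed

text \<open>
  Applying the Jacobi identity to \<open>X\<close>, \<open>Y\<close> and \<open>f E u\<close> and expanding by the product rule leaves
  \<open>(X (Y f) - Y (X f) - [X, Y] f) E u = 0\<close>.
\<close>

lemma field_deriv_commutator:
  assumes X: "smooth_field A X" and Y: "smooth_field A Y" and f: "smooth_fun A f"
  shows "field_deriv A (lie_bracket A X Y) f p =
    field_deriv A X (field_deriv A Y f) p - field_deriv A Y (field_deriv A X f) p"
proof -
  obtain u v where uv: "\<And>p. g p (E u p) (E v p) = 1"
    using dual_frame_vectors by blast
  have *: "lie_bracket A X (lie_bracket A Y (\<lambda>p. f p *\<^sub>R E u p)) p =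
      field_deriv A X (field_deriv A Y f) p *\<^sub>R E u p
      + field_deriv A Y f p *\<^sub>R lie_bracket A X (E u) p
      + (field_deriv A X f p *\<^sub>R lie_bracket A Y (E u) p
      + f p *\<^sub>R lie_bracket A X (lie_bracket A Y (E u)) p)"
    if "smooth_field A X" "smooth_field A Y" for X Y
    using that f
    by (simp add: lie_bracket_scaleR_right lie_bracket_add_right smooth_E smooth_field_deriv
        smooth_field_scaleR[OF atlas] smooth_lie_bracket)
  have "(field_deriv A X (field_deriv A Y f) p - field_deriv A Y (field_deriv A X f) p
      - field_deriv A (lie_bracket A X Y) f p) *\<^sub>R E u p = 0"
    using lie_bracket_leibniz[OF X Y, of "\<lambda>p. f p *\<^sub>R E u p" p] lie_bracket_leibniz[OF X Y smooth_E, of u p]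
      smooth_field_scaleR[OF atlas f smooth_E, of u]
    unfolding *[OF X Y] *[OF Y X]
    by (simp add: lie_bracket_scaleR_right[OF f smooth_lie_bracket[OF X Y] smooth_E] algebra_simps)
  moreover have "E u p \<noteq> 0"
    using uv[of p] bilinear_lzero[OF bilinear_metric] by (metis zero_neq_one)
  ultimately show ?thesis by simp
qed

section \<open>Tensoriality of the curvature\<close>

lemma curvature_anti:
  assumes "smooth_field A X" "smooth_field A Y" "smooth_field A Z"
  shows "curvature A D Y X Z p = - curvature A D X Y Z p"
  using D_scaleR_left[OF smooth_fun_const smooth_lie_bracket[OF assms(1,2)] assms(3), of "-1"]
  by (simp add: curvature_def lie_bracket_anti[OF assms(1,2)])

lemma curvature_add_right:
  assumes "smooth_field A X" "smooth_field A Y" "smooth_field A Z" "smooth_field A Z'"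
  shows "curvature A D X Y (\<lambda>p. Z p + Z' p) p = curvature A D X Y Z p + curvature A D X Y Z' p"
  using assms by (simp add: curvature_def D_add_right smooth_D smooth_lie_bracket)

lemma curvature_add_middle:
  assumes "smooth_field A X" "smooth_field A Y" "smooth_field A Y'" "smooth_field A Z"
  shows "curvature A D X (\<lambda>p. Y p + Y' p) Z p = curvature A D X Y Z p + curvature A D X Y' Z p"
  using assms
  by (simp add: curvature_def D_add_right D_add_left lie_bracket_add_right smooth_D smooth_lie_bracket)

text \<open>The term with \<open>X f\<close> from differentiating \<open>f *\<^sub>R D Y Z\<close>
  cancels against the one from the bracket of \<open>X\<close> with the multiple of
  \<open>Y\<close>.\<close>

lemma curvature_scaleR_middle:
  assumes "smooth_field A X" "smooth_field A Y" "smooth_field A Z" "smooth_fun A f"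
  shows "curvature A D X (\<lambda>p. f p *\<^sub>R Y p) Z p = f p *\<^sub>R curvature A D X Y Z p"
  using assms
  by (simp add: curvature_def D_scaleR_left D_scaleR_right D_add_left lie_bracket_scaleR_right smooth_D
      smooth_lie_bracket smooth_field_deriv smooth_field_scaleR[OF atlas] algebra_simps)

text \<open>First derivatives of \<open>f\<close> along \<open>X\<close> and \<open>Y\<close> cancel
  crosswise; the second-order terms cancel by \<open>field_deriv_commutator\<close>.\<close>

lemma curvature_scaleR_right:
  assumes "smooth_field A X" "smooth_field A Y" "smooth_field A Z" "smooth_fun A f"
  shows "curvature A D X Y (\<lambda>p. f p *\<^sub>R Z p) p = f p *\<^sub>R curvature A D X Y Z p"
  using assms
  by (simp add: curvature_def D_scaleR_right D_add_right field_deriv_commutator smooth_D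
      smooth_lie_bracket smooth_field_deriv smooth_field_scaleR[OF atlas] algebra_simps)

text \<open>Frame induction on one argument at a time: the last, then the middle, and finally the
  first, which antisymmetry turns into a middle one.\<close>

lemma curvature_eq_zero_if_left_invariant:
  assumes frame: "\<And>u v w p. curvature A D (E u) (E v) (E w) p = 0"
    and X: "smooth_field A X" and Y: "smooth_field A Y" and Z: "smooth_field A Z"
  shows "curvature A D X Y Z p = 0"
proof -
  have 1: "\<forall>p. curvature A D (E u) (E v) Z p = 0" if "smooth_field A Z" for u v Z
    using that
    by (rule frame_induct[where P = "\<lambda>Z. \<forall>p. curvature A D (E u) (E v) Z p = 0"])
      (simp_all add: curvature_add_right curvature_scaleR_right smooth_E frame)
  have 2: "\<forall>p. curvature A D (E u) Y Z p = 0" if "smooth_field A Y" for u Y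
    using that
    by (rule frame_induct[where P = "\<lambda>Y. \<forall>p. curvature A D (E u) Y Z p = 0"])
      (simp_all add: curvature_add_middle curvature_scaleR_middle smooth_E 1 Z)
  have 3: "curvature A D Y (E v) Z p = 0" for v p
    using curvature_anti[OF smooth_E Y Z, of v p] 2[OF Y] by simp
  have "\<forall>p. curvature A D Y X Z p = 0"
    using X
    by (rule frame_induct[where P = "\<lambda>X. \<forall>p. curvature A D Y X Z p = 0"])
      (simp_all add: curvature_add_middle curvature_scaleR_middle smooth_E 3 Y Z)
  then show ?thesis
    using curvature_anti[OF Y X Z] by simp
qed

section \<open>Connection and curvature on left invariant fields\<close>

lemma lie_bracket_E: "lie_bracket A (E u) (E v) = E (lie_bracket A (E u) (E v) 0)"
  by (intro lie_algebra_eq_E lie_bracket_in_lie_algebra lie left_field_in_lie_algebra smooth_lie_bracket smooth_E)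

text \<open>On left invariant fields inner products are constant and brackets are left invariant, so
  the right-hand side of the Koszul formula does not depend on \<open>p\<close>. As the frame spans
  each tangent space, nondegeneracy concludes.\<close>

lemma D_E: "D (E u) (E v) = E (D (E u) (E v) 0)"
proof
  fix p
  have koszul: "2 * g p (D (E u) (E v) p) (E w p) =
      g 0 (lie_bracket A (E u) (E v) 0) w - g 0 (lie_bracket A (E u) (E w) 0) v
      - g 0 (lie_bracket A (E v) (E w) 0) u" for w p
    using levi_civita_koszul[OF metric levi_civita smooth_E smooth_E smooth_E, of p u v w]
      metric_E[of p "lie_bracket A (E u) (E v) 0" w] metric_E[of p "lie_bracket A (E u) (E w) 0" v]
      metric_E[of p "lie_bracket A (E v) (E w) 0" u]
    by (simp add: metric_E field_deriv_const lie_bracket_E[symmetric])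
  have "g p (D (E u) (E v) p - E (D (E u) (E v) 0) p) z = 0" for z
  proof -
    obtain w where w: "E w p = z"
      using left_field_surj[OF lie] by blast
    have "g p (E (D (E u) (E v) 0) p) (E w p) = g 0 (D (E u) (E v) 0) w"
      by (rule metric_E)
    then show ?thesis
      using koszul[of p w] koszul[of 0 w] w
      by (simp add: bilinear_lsub[OF bilinear_metric] left_field_0[OF lie])
  qed
  then show "D (E u) (E v) p = E (D (E u) (E v) 0) p"
    using metric_nondegenerate by (metis eq_iff_diff_eq_0)
qed

text \<open>The product written \<open>u \<cdot> v\<close> in the overview.\<close>

definition nabla0 :: "'e \<Rightarrow> 'e \<Rightarrow> 'e" where
  "nabla0 u v = D (E u) (E v) 0"

lemma D_E_nabla0: "D (E u) (E v) = E (nabla0 u v)"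
  unfolding nabla0_def by (rule D_E)

lemma bilinear_nabla0: "bilinear nabla0"
  unfolding bilinear_def
  by (auto intro!: linearI simp: nabla0_def E_add E_scaleR D_add_left D_add_right smooth_E field_deriv_const
      D_scaleR_left[OF smooth_fun_const] D_scaleR_right[OF smooth_fun_const])

lemma E_diff: "E (u - v) = (\<lambda>p. E u p - E v p)"
  using linear_diff[OF linear_E] by blast

lemma lie_bracket_E_nabla0: "lie_bracket A (E u) (E v) = E (nabla0 u v - nabla0 v u)"
  by (simp add: lie_bracket_eq smooth_E D_E_nabla0 E_diff)

lemma curvature_E:
  "curvature A D (E u) (E v) (E w) = E (nabla0 u (nabla0 v w) - nabla0 v (nabla0 u w) - nabla0 (nabla0 u v - nabla0 v u) w)"
  unfolding fun_eq_iff curvature_def lie_bracket_E_nabla0 D_E_nabla0 by (simp add: E_diff)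

text \<open>Metric compatibility, where the derivative of the constant inner product
  vanishes.\<close>

lemma nabla0_compatible: "g 0 (nabla0 u v) w + g 0 v (nabla0 u w) = 0"
proof -
  have "field_deriv A (E u) (\<lambda>q. g q (E v q) (E w q)) 0 =
      g 0 (D (E u) (E v) 0) (E w 0) + g 0 (E v 0) (D (E u) (E w) 0)"
    using levi_civita smooth_E by (simp add: levi_civita_def metric_compatible_def)
  then show ?thesis
    by (simp add: metric_E field_deriv_const nabla0_def left_field_0[OF lie])
qed

lemma nabla0_jacobi:
  "nabla0 u (nabla0 v w - nabla0 w v) - nabla0 (nabla0 v w - nabla0 w v) u
    + (nabla0 v (nabla0 w u - nabla0 u w) - nabla0 (nabla0 w u - nabla0 u w) v)
    + (nabla0 w (nabla0 u v - nabla0 v u) - nabla0 (nabla0 u v - nabla0 v u) w) = 0"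
  using lie_bracket_jacobi[OF atlas smooth_E smooth_E smooth_E, of u v w 0]
  by (simp add: lie_bracket_E_nabla0 left_field_0[OF lie])

end

section \<open>Flatness, by reduction to the tangent space at the identity\<close>

theorem theorem4p6:
  fixes A :: "('g::{group_add, t2_space, second_countable_topology}, 'e::euclidean_space) chart set"
    and g :: "'g \<Rightarrow> 'e \<Rightarrow> 'e \<Rightarrow> real"
    and J :: "'g \<Rightarrow> 'e \<Rightarrow> 'e"
  assumes "lie_group A"
    and "left_invariant_anti_kaehler A g J"
    and "abelian_complex_structure A J"
  shows "flat A g"
  unfolding flat_def
proof (intro allI impI)
  fix D X Y Z p
  assume D: "levi_civita A g D" and smooth: "smooth_field A X" "smooth_field A Y" "smooth_field A Z"
  have ak: "anti_kaehler A g J" and g: "left_invariant_metric A g" and J: "left_invariant_endomorphism A J"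
    using assms(2) by (auto simp: left_invariant_anti_kaehler_def)
  have metric: "pseudo_riemannian_metric A g" and acs: "almost_complex_structure A J"
    and anti: "\<And>p v w. g p (J p v) (J p w) = - g p v w"
    using ak by (auto simp: anti_kaehler_def)
  have J_linear: "linear (J p)" and JJ: "J p (J p v) = - v"
    and J_smooth: "smooth_field A X \<Longrightarrow> smooth_field A (\<lambda>p. J p (X p))" for p v X
    using acs by (auto simp: almost_complex_structure_def)
  interpret left_invariant_levi_civita A g D
    using assms(1) metric g D by unfold_locales
  \<comment> \<open>\<open>flat\<close> concerns every Levi-Civita connection, while
    \<open>anti_kaehler\<close> makes \<open>J\<close> parallel for some \<open>D'\<close>. Both
    satisfy the Koszul formula, so \<open>D'\<close> and \<open>D\<close> agree on smooth fields and
    \<open>J\<close> is parallel for \<open>D\<close>.\<close>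
  obtain D' where D': "levi_civita A g D'" "parallel A D' J"
    using ak by (auto simp: anti_kaehler_def)
  have unique: "D' X Y p = D X Y p" if "smooth_field A X" "smooth_field A Y" for X Y p
  proof -
    have "g p (D' X Y p - D X Y p) w = 0" for w
    proof -
      obtain v where v: "E v p = w"
        using left_field_surj[OF lie] by blast
      show ?thesis
        using levi_civita_koszul[OF metric D'(1) that smooth_E, of p v]
          levi_civita_koszul[OF metric D that smooth_E, of p v]
        by (simp add: v bilinear_lsub[OF bilinear_metric])
    qed
    then show ?thesis
      using metric_nondegenerate by (metis eq_iff_diff_eq_0)
  qed
  \<comment> \<open>Left invariance of \<open>J\<close> makes it preserve left invariant fields, so
    on them it acts as the single linear map \<open>J 0\<close>.\<close>
  have J_E: "(\<lambda>p. J p (E v p)) = E (J 0 v)" for v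
  proof -
    have "left_translation A a p (J p (E v p)) = J (a + p) (E v (a + p))" for a p
    proof -
      have "left_translation A a p (E v p) = E v (a + p)"
        using left_field_in_lie_algebra[OF lie] unfolding lie_algebra_def by blast
      moreover have "J (a + p) (left_translation A a p (E v p)) = left_translation A a p (J p (E v p))"
        using J unfolding left_invariant_endomorphism_def by blast
      ultimately show ?thesis by simp
    qed
    then have "(\<lambda>p. J p (E v p)) \<in> lie_algebra A"
      using J_smooth[OF smooth_E] by (simp add: lie_algebra_def)
    from lie_algebra_eq_E[OF this] show ?thesis
      by (simp add: left_field_0[OF lie])
  qed
  have "nabla0 u (nabla0 v w) - nabla0 v (nabla0 u w) - nabla0 (nabla0 u v - nabla0 v u) w = 0" for u v w
  proof (rule abelian_anti_kaehler_product_flat[where m = nabla0 and j = "J 0" and B = "g 0"])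
    show "u = 0" if "\<And>w. g 0 u w = 0" for u
      using metric_nondegenerate that by blast
    show "nabla0 u (J 0 v) = J 0 (nabla0 u v)" for u v
    proof -
      have "D' (E u) (\<lambda>q. J q (E v q)) 0 = J 0 (D' (E u) (E v) 0)"
        using D'(2) smooth_E by (simp add: parallel_def)
      then show ?thesis
        by (simp add: J_E unique smooth_E nabla0_def)
    qed
    show "nabla0 (J 0 u) (J 0 v) - nabla0 (J 0 v) (J 0 u) = nabla0 u v - nabla0 v u" for u v
    proof -
      have "lie_bracket A (\<lambda>p. J p (E u p)) (\<lambda>p. J p (E v p)) = lie_bracket A (E u) (E v)"
        using assms(3) left_field_in_lie_algebra[OF lie] by (simp add: abelian_complex_structure_def)
      from fun_cong[OF this, of 0] show ?thesis
        by (simp add: J_E lie_bracket_E_nabla0 left_field_0[OF lie])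
    qed
  qed (rule bilinear_nabla0 J_linear JJ bilinear_metric metric_commute nabla0_compatible anti nabla0_jacobi)+
  then have "curvature A D (E u) (E v) (E w) p = 0" for u v w p
    using linear_0[OF linear_E] by (simp add: curvature_E)
  then show "curvature A D X Y Z p = 0"
    using smooth by (rule curvature_eq_zero_if_left_invariant)
qed

end
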